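(* Let $n\ge 1$, $s\in\{0,1,\ldots,n-1\}$, and $f\in C^2(\mathbb{R}^n,\mathbb{R})$. Suppose that $\bar x\in\mathbb{R}^{n,s}$ is a nondegenerate M-stationary point for SCNO with $\|\bar x\|_0=k$ and quadratic index $QI$, where the coordinates are ordered so that $I_0(\bar x)=\{1,\ldots,n-k\}$ and $I_1(\bar x)=\{n-k+1,\ldots,n\}$. Then there exist neighborhoods $U_{\bar x}$ and $V_0$ of $\bar x$ and $0$, respectively, and a local $C^1$-coordinate system $\Psi:U_{\bar x}\to V_0$ of $\mathbb{R}^n$ around $\bar x$ such that $$f\circ\Psi^{-1}(y)=f(\bar x)+\sum_{i=1}^{n-k}y_i+\sum_{j=n-k+1}^{n}\pm y_j^2,$$ where $y\in\mathbb{R}^{n-k,s-k}\times\mathbb{R}^k$. Moreover, there are exactly $QI$ negative squares in this formula.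
   Context: For $x\in\mathbb{R}^m$, $\|x\|_0$ is the number of non-zero entries of $x$, and $\mathbb{R}^{m,l}=\{x\in\mathbb{R}^m : \|x\|_0\le l\}$. SCNO (sparsity constrained nonlinear optimization) is the problem $\min f(x)$ s.t. $x\in\mathbb{R}^{n,s}$. For $x\in\mathbb{R}^{n,s}$ put $I_0(x)=\{i: x_i=0\}$ and $I_1(x)=\{i: x_i\neq 0\}$. A point $\bar x\in\mathbb{R}^{n,s}$ is M-stationary for SCNO if $\frac{\partial f}{\partial x_i}(\bar x)=0$ for all $i\in I_1(\bar x)$. An M-stationary point $\bar x$ with $\|\bar x\|_0=k$ is nondegenerate if: (ND1) if $k<s$ then $\frac{\partial f}{\partial x_i}(\bar x)\ne0$ for all $i\in I_0(\bar x)$; and (ND2) the matrix $\left(\frac{\partial^2 f}{\partial x_i\partial x_j}(\bar x)\right)_{i,j\in I_1(\bar x)}$ is nonsingular. For a nondegenerate M-stationary point, the quadratic index $QI$ is the number of negative eigenvalues of the matrix in ND2. *)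

theory Defs
  imports "HOL-Analysis.Analysis"
begin

definition I0 :: "real^'n \<Rightarrow> 'n set" where
  "I0 x = {i. x $ i = 0}"

definition I1 :: "real^'n \<Rightarrow> 'n set" where
  "I1 x = {i. x $ i \<noteq> 0}"

definition l0_norm :: "real^'n \<Rightarrow> nat" where
  "l0_norm x = card (I1 x)"

definition sparse_set :: "nat \<Rightarrow> (real^'n) set" where
  "sparse_set l = {x. l0_norm x \<le> l}"

text \<open>If the coordinates in \<open>J\<close> are listed first, \<open>sparse_block J l\<close> is the product of the
  \<open>l\<close>-sparse vectors in the coordinates \<open>J\<close> with the full space in the remaining coordinates.\<close>

definition sparse_block :: "'n set \<Rightarrow> nat \<Rightarrow> (real^'n) set" where
  "sparse_block J l = {y. card {i \<in> J. y $ i \<noteq> 0} \<le> l}"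

text \<open>The definitions of \<open>C\<^sup>1\<close> and \<open>C\<^sup>2\<close> are meant for open sets \<open>S\<close>. In the second one the
  derivative takes its values in the normed space of bounded linear maps.\<close>

definition C1_on :: "'a::real_normed_vector set \<Rightarrow> ('a \<Rightarrow> 'b::real_normed_vector) \<Rightarrow> bool" where
  "C1_on S f \<longleftrightarrow> (\<exists>f'. (\<forall>x\<in>S. (f has_derivative blinfun_apply (f' x)) (at x)) \<and> continuous_on S f')"

definition C2_on :: "'a::real_normed_vector set \<Rightarrow> ('a \<Rightarrow> 'b::real_normed_vector) \<Rightarrow> bool" where
  "C2_on S f \<longleftrightarrow> (\<exists>f'. (\<forall>x\<in>S. (f has_derivative blinfun_apply (f' x)) (at x)) \<and> C1_on S f')"

definition partial :: "'n \<Rightarrow> (real^'n \<Rightarrow> real) \<Rightarrow> real^'n \<Rightarrow> real" where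
  "partial i f x = deriv (\<lambda>t. f (x + t *\<^sub>R axis i 1)) 0"

definition hessian :: "(real^'n \<Rightarrow> real) \<Rightarrow> real^'n \<Rightarrow> 'n \<Rightarrow> 'n \<Rightarrow> real" where
  "hessian f x i j = partial i (partial j f) x"

text \<open>A square matrix with rows and columns indexed by a set \<open>J\<close> of coordinates is given by a
  function \<open>A\<close> of which only the values \<open>A i j\<close> with \<open>i, j \<in> J\<close> are used; a vector indexed by
  \<open>J\<close> is a vector vanishing outside \<open>J\<close>.\<close>

definition nonsingular_on :: "'n::finite set \<Rightarrow> ('n \<Rightarrow> 'n \<Rightarrow> real) \<Rightarrow> bool" where
  "nonsingular_on J A \<longleftrightarrow> (\<exists>B. \<forall>i\<in>J. \<forall>j\<in>J.
     (\<Sum>l\<in>J. A i l * B l j) = (if i = j then 1 else 0) \<and>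
     (\<Sum>l\<in>J. B i l * A l j) = (if i = j then 1 else 0))"

definition eigenspace_on :: "'n::finite set \<Rightarrow> ('n \<Rightarrow> 'n \<Rightarrow> real) \<Rightarrow> real \<Rightarrow> (real^'n) set" where
  "eigenspace_on J A c =
     {v. (\<forall>i. i \<notin> J \<longrightarrow> v $ i = 0) \<and> (\<forall>i\<in>J. (\<Sum>j\<in>J. A i j * v $ j) = c * v $ i)}"

definition eigenvalue_on :: "'n::finite set \<Rightarrow> ('n \<Rightarrow> 'n \<Rightarrow> real) \<Rightarrow> real \<Rightarrow> bool" where
  "eigenvalue_on J A c \<longleftrightarrow> (\<exists>v \<in> eigenspace_on J A c. v \<noteq> 0)"

text \<open>Eigenvalues are counted with multiplicity. Geometric multiplicity is used; for the symmetric
  matrices considered here it agrees with algebraic multiplicity.\<close>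

definition num_neg_eigenvalues_on :: "'n::finite set \<Rightarrow> ('n \<Rightarrow> 'n \<Rightarrow> real) \<Rightarrow> nat" where
  "num_neg_eigenvalues_on J A = (\<Sum>c | c < 0 \<and> eigenvalue_on J A c. dim (eigenspace_on J A c))"

definition M_stationary :: "nat \<Rightarrow> (real^'n \<Rightarrow> real) \<Rightarrow> real^'n \<Rightarrow> bool" where
  "M_stationary s f x \<longleftrightarrow> x \<in> sparse_set s \<and> (\<forall>i\<in>I1 x. partial i f x = 0)"

definition nondegenerate_M_stationary :: "nat \<Rightarrow> (real^'n \<Rightarrow> real) \<Rightarrow> real^'n \<Rightarrow> bool" where
  "nondegenerate_M_stationary s f x \<longleftrightarrow>
     M_stationary s f x \<and>
     (l0_norm x < s \<longrightarrow> (\<forall>i\<in>I0 x. partial i f x \<noteq> 0)) \<and>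
     nonsingular_on (I1 x) (hessian f x)"

definition quadratic_index :: "(real^'n \<Rightarrow> real) \<Rightarrow> real^'n \<Rightarrow> nat" where
  "quadratic_index f x = num_neg_eigenvalues_on (I1 x) (hessian f x)"

definition local_C1_coordinates ::
    "real^'n \<Rightarrow> (real^'n) set \<Rightarrow> (real^'n) set \<Rightarrow> (real^'n \<Rightarrow> real^'n) \<Rightarrow> bool" where
  "local_C1_coordinates x U V \<Psi> \<longleftrightarrow>
     open U \<and> x \<in> U \<and> open V \<and> 0 \<in> V \<and> \<Psi> x = 0 \<and>
     bij_betw \<Psi> U V \<and> C1_on U \<Psi> \<and> C1_on V (inv_into U \<Psi>)"

end

theory Submission
  imports Defs
begin

text \<open>
  Let \<open>J\<close> be the support of the base point. Its coordinates are straightened by a Morse lemma for the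
  restriction of \<open>f\<close> to the vectors supported in \<open>J\<close>. For a function that is only \<open>C\<^sup>2\<close> the textbook
  substitution \<open>y = B(z) z\<close> with \<open>B\<close> a square root of the averaged Hessian need not be \<open>C\<^sup>1\<close>, so the
  variables are split off one at a time in a basis of eigenvectors of the Hessian. If
  \<open>\<partial>\<^sub>u\<^sub>ug(0) \<noteq> 0\<close>, the implicit function theorem gives the critical value \<open>u = h(w)\<close> of \<open>g(\<cdot>, w)\<close>; the
  reduced function \<open>g(h(w), w)\<close> is again \<open>C\<^sup>2\<close>, because its gradient is that of \<open>g\<close> evaluated at
  \<open>(h(w), w)\<close>, and the signed square root of \<open>\<bar>g(u, w) - g(h(w), w)\<bar>\<close> is a \<open>C\<^sup>1\<close> function of \<open>(u, w)\<close>.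

  If \<open>k < s\<close>, the remaining coordinates are the increments of \<open>f\<close> obtained by switching on the
  coordinates outside \<open>J\<close> one after the other. Such an increment vanishes exactly where its coordinate
  does, since the partial derivative is nonzero by ND1, so sparsity is preserved. If \<open>k = s\<close>, only points
  supported in \<open>J\<close> matter and the coordinates outside \<open>J\<close> are kept.
\<close>

subsection \<open>Continuously differentiable maps\<close>

text \<open>Continuity in operator norm reduces, on a Euclidean domain, to continuity along the
  finitely many basis vectors. Derivatives can then be supplied as plain functions, without handling
  \<open>Blinfun\<close> each time.\<close>

lemma C1_onI:
  fixes f :: "'a::euclidean_space \<Rightarrow> 'b::real_normed_vector"
  assumes D: "\<And>x. x \<in> S \<Longrightarrow> (f has_derivative D x) (at x)"
    and cont: "\<And>v. v \<in> Basis \<Longrightarrow> continuous_on S (\<lambda>x. D x v)"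
  shows "C1_on S f"
proof -
  have *: "blinfun_apply (Blinfun (D x)) = D x" if "x \<in> S" for x
    using D[OF that] has_derivative_bounded_linear bounded_linear_Blinfun_apply by blast
  have "continuous_on S (\<lambda>x. Blinfun (D x))"
  proof (rule continuous_on_blinfun_componentwise)
    fix v :: 'a assume "v \<in> Basis"
    then show "continuous_on S (\<lambda>x. blinfun_apply (Blinfun (D x)) v)"
      using cont[of v] by (simp add: * cong: continuous_on_cong_simp)
  qed
  then show ?thesis
    unfolding C1_on_def using D * by (intro exI[of _ "\<lambda>x. Blinfun (D x)"]) auto
qed

section \<open>Calculus rules for C^1 maps\<close>

lemma C1_on_subset: "C1_on S f \<Longrightarrow> T \<subseteq> S \<Longrightarrow> C1_on T f"
  unfolding C1_on_def by (meson continuous_on_subset subsetD)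

lemma C1_on_imp_continuous_on: "C1_on S f \<Longrightarrow> continuous_on S f"
  unfolding C1_on_def
  by (meson continuous_at_imp_continuous_on has_derivative_continuous)

lemma C1_on_cong:
  assumes "C1_on S f" "open S" "\<And>x. x \<in> S \<Longrightarrow> f x = g x"
  shows "C1_on S g"
proof -
  obtain f' where f': "\<forall>x\<in>S. (f has_derivative blinfun_apply (f' x)) (at x)" "continuous_on S f'"
    using assms unfolding C1_on_def by auto
  then have "\<forall>x\<in>S. (g has_derivative blinfun_apply (f' x)) (at x)"
    using has_derivative_transform_within_open assms(2,3) by blast
  then show ?thesis unfolding C1_on_def using f'(2) by auto
qed

lemma C1_on_add:
  assumes "C1_on S f" "C1_on S g"
  shows "C1_on S (\<lambda>x. f x + g x)"
proof -
  obtain f' g' where "\<forall>x\<in>S. (f has_derivative blinfun_apply (f' x)) (at x)" "continuous_on S f'"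
    "\<forall>x\<in>S. (g has_derivative blinfun_apply (g' x)) (at x)" "continuous_on S g'"
    using assms unfolding C1_on_def by auto
  then show ?thesis unfolding C1_on_def
    by (intro exI[of _ "\<lambda>x. f' x + g' x"])
      (auto intro!: continuous_intros derivative_eq_intros simp: blinfun.add_left)
qed

lemma C1_on_bounded_linear: "bounded_linear f \<Longrightarrow> C1_on S f"
  unfolding C1_on_def
  by (intro exI[of _ "\<lambda>x. Blinfun f"])
    (auto simp: bounded_linear_Blinfun_apply bounded_linear_imp_has_derivative)

lemma C1_on_const: "C1_on S (\<lambda>x. c)"
  unfolding C1_on_def by (intro exI[of _ "\<lambda>x. 0"]) (auto intro!: derivative_eq_intros)

lemma C1_on_compose:
  assumes "C1_on T g" "C1_on S f" "f ` S \<subseteq> T"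
  shows "C1_on S (\<lambda>x. g (f x))"
proof -
  obtain f' g' where f: "\<forall>x\<in>S. (f has_derivative blinfun_apply (f' x)) (at x)" "continuous_on S f'"
    and g: "\<forall>x\<in>T. (g has_derivative blinfun_apply (g' x)) (at x)" "continuous_on T g'"
    using assms(1,2) unfolding C1_on_def by auto
  have "((\<lambda>x. g (f x)) has_derivative blinfun_apply (g' (f x) o\<^sub>L f' x)) (at x)" if "x \<in> S" for x
    using has_derivative_compose[of f "blinfun_apply (f' x)" x UNIV g "blinfun_apply (g' (f x))"]
      f(1) g(1) that assms(3) by (auto simp: blinfun_compose.rep_eq o_def)
  moreover have "continuous_on S (\<lambda>x. g' (f x) o\<^sub>L f' x)"
    by (intro continuous_intros continuous_on_compose2[OF g(2)] f(2)
        C1_on_imp_continuous_on[OF assms(2)] assms(3))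
  ultimately show ?thesis unfolding C1_on_def by (intro exI conjI) auto
qed

lemma C1_on_linear_compose:
  "bounded_linear L \<Longrightarrow> C1_on S f \<Longrightarrow> C1_on S (\<lambda>x. L (f x))"
  using C1_on_compose[OF C1_on_bounded_linear[of L UNIV]] by auto

lemma C1_on_diff:
  assumes "C1_on S f" "C1_on S g"
  shows "C1_on S (\<lambda>x. f x - g x)"
  using C1_on_add[OF assms(1) C1_on_linear_compose[OF _ assms(2), of uminus]]
  by (simp add: bounded_linear_minus)

lemma C1_on_sum:
  "(\<And>i. i \<in> I \<Longrightarrow> C1_on S (f i)) \<Longrightarrow> C1_on S (\<lambda>x. \<Sum>i\<in>I. f i x)"
  by (induction I rule: infinite_finite_induct) (auto intro: C1_on_add C1_on_const)

lemma C1_on_vec: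
  fixes f :: "'a::real_normed_vector \<Rightarrow> real^'n"
  assumes "\<And>i. C1_on S (\<lambda>x. f x $ i)"
  shows "C1_on S f"
proof -
  have "C1_on S (\<lambda>x. \<Sum>i\<in>UNIV. f x $ i *\<^sub>R axis i (1::real))"
    by (intro C1_on_sum C1_on_linear_compose[OF _ assms] bounded_linear_intros)
  moreover have "(\<Sum>i\<in>UNIV. f x $ i *\<^sub>R axis i (1::real)) = f x" for x
    by (simp add: vec_eq_iff axis_def if_distrib cong: if_cong)
  ultimately show ?thesis by simp
qed

text \<open>The resolvent identity \<open>eq\<close> bounds the difference of the inverses by
  \<open>norm (A x0 - A x)\<close> times the norms of both inverses. The unknown norm of
  \<open>B x\<close> is absorbed into the left side once \<open>A x\<close> is close to
  \<open>A x0\<close>.\<close>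

lemma continuous_on_inverse_blinfun:
  fixes A B :: "'a::topological_space \<Rightarrow> 'b::real_normed_vector \<Rightarrow>\<^sub>L 'b"
  assumes "continuous_on S A"
    and inv: "\<And>x. x \<in> S \<Longrightarrow> A x o\<^sub>L B x = id_blinfun" "\<And>x. x \<in> S \<Longrightarrow> B x o\<^sub>L A x = id_blinfun"
  shows "continuous_on S B"
  unfolding continuous_on_def
proof
  fix x0 assume x0: "x0 \<in> S"
  define \<beta> where "\<beta> = norm (B x0)"
  have AB: "A x (B x v) = v" "B x (A x v) = v" if "x \<in> S" for x v
    using inv[OF that] by (metis blinfun_apply_blinfun_compose id_blinfun.rep_eq id_apply)+
  have eq: "B x - B x0 = B x o\<^sub>L (A x0 - A x) o\<^sub>L B x0" if "x \<in> S" for x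
    by (rule blinfun_eqI) (simp add: blinfun.bilinear_simps AB that x0)
  have lim: "((\<lambda>x. norm (A x0 - A x)) \<longlongrightarrow> 0) (at x0 within S)"
  proof -
    have "(A \<longlongrightarrow> A x0) (at x0 within S)"
      using assms(1) x0 unfolding continuous_on_def by blast
    then have "((\<lambda>x. norm (A x0 - A x)) \<longlongrightarrow> norm (A x0 - A x0)) (at x0 within S)"
      by (intro tendsto_intros)
    then show ?thesis by simp
  qed
  \<comment> \<open>This threshold makes \<open>norm (A x0 - A x) * \<beta>\<close> at most 1/2,
    which yields \<open>norm (B x) \<le> 2 * \<beta>\<close>; the summand 1 keeps the denominator
    positive when \<open>\<beta> = 0\<close>.\<close>
  have "\<forall>\<^sub>F x in at x0 within S. norm (A x0 - A x) < 1 / (2 * (\<beta> + 1))"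
    using order_tendstoD(2)[OF lim, of "1 / (2 * (\<beta> + 1))"] by (auto simp: \<beta>_def add_nonneg_pos)
  moreover have "\<forall>\<^sub>F x in at x0 within S. x \<in> S"
    by (simp add: eventually_at_filter)
  ultimately have "\<forall>\<^sub>F x in at x0 within S. norm (B x - B x0) \<le> (2 * \<beta> * \<beta>) * norm (A x0 - A x)"
  proof eventually_elim
    case (elim x)
    have \<beta>0: "\<beta> \<ge> 0" by (simp add: \<beta>_def)
    have 1: "norm (B x - B x0) \<le> norm (B x) * norm (A x0 - A x) * \<beta>"
      unfolding eq[OF elim(2)] \<beta>_def
      by (meson mult_right_mono norm_blinfun_compose norm_ge_zero order_trans)
    have "norm (A x0 - A x) * \<beta> \<le> 1 / (2 * (\<beta> + 1)) * \<beta>"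
      using elim(1) \<beta>0 by (intro mult_right_mono) auto
    also have "\<dots> \<le> 1/2" using \<beta>0 by (simp add: divide_simps)
    finally have "norm (B x) * (norm (A x0 - A x) * \<beta>) \<le> norm (B x) * (1/2)"
      by (intro mult_left_mono) auto
    then have "norm (B x - B x0) \<le> norm (B x) / 2" using 1 by (simp add: mult.assoc)
    moreover have "norm (B x) \<le> norm (B x - B x0) + \<beta>"
      unfolding \<beta>_def using norm_triangle_ineq[of "B x - B x0" "B x0"] by simp
    ultimately have "norm (B x) \<le> 2 * \<beta>" by simp
    then have "norm (B x) * (norm (A x0 - A x) * \<beta>) \<le> 2 * \<beta> * (norm (A x0 - A x) * \<beta>)"
      using \<beta>0 by (intro mult_right_mono) auto
    then show ?case using 1 by (simp add: mult_ac)
  qed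
  moreover have "((\<lambda>x. (2 * \<beta> * \<beta>) * norm (A x0 - A x)) \<longlongrightarrow> 0) (at x0 within S)"
    using tendsto_mult_right_zero[OF lim] by auto
  ultimately have "((\<lambda>x. B x - B x0) \<longlongrightarrow> 0) (at x0 within S)"
    by (rule Lim_null_comparison)
  then show "(B \<longlongrightarrow> B x0) (at x0 within S)" by (simp add: LIM_zero_iff)
qed

text \<open>The derivative of the local inverse \<open>K\<close> at \<open>y\<close> is the inverse
  of \<open>f' (K y)\<close>, hence continuous in \<open>y\<close> by
  \<open>continuous_on_inverse_blinfun\<close>. A trivial kernel is all that is asked of
  \<open>D\<close>, because an injective linear map has a linear left inverse.\<close>

lemma C1_inverse_function:
  fixes F :: "'a::euclidean_space \<Rightarrow> 'a"
  assumes W: "open W" "x0 \<in> W" and C1: "C1_on W F"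
    and D: "(F has_derivative D) (at x0)" and inj: "\<And>v. D v = 0 \<Longrightarrow> v = 0"
  obtains U V where "open U" "x0 \<in> U" "U \<subseteq> W" "open V" "bij_betw F U V" "C1_on V (inv_into U F)"
proof -
  obtain f' where f': "\<And>x. x \<in> W \<Longrightarrow> (F has_derivative blinfun_apply (f' x)) (at x)"
    "continuous_on W f'"
    using C1 unfolding C1_on_def by auto
  have D_eq: "D = blinfun_apply (f' x0)"
    using has_derivative_unique[OF D f'(1)] W by auto
  have linD: "linear D" using D has_derivative_linear by blast
  have "inj D" using inj linear_injective_0[OF linD] by blast
  then obtain E where E: "linear E" "E \<circ> D = id"
    using linear_injective_left_inverse linD by blast
  have "Blinfun E o\<^sub>L f' x0 = id_blinfun"
    using E D_eq by (intro blinfun_eqI)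
      (simp add: bounded_linear_Blinfun_apply linear_conv_bounded_linear[symmetric] pointfree_idE)
  from inverse_function_theorem[OF W(1) f' W(2) this] obtain U V K K' where
    UV: "open U" "U \<subseteq> W" "x0 \<in> U" "open V" "homeomorphism U V F K"
    "\<And>y. y \<in> V \<Longrightarrow> (K has_derivative K' y) (at y)"
    "\<And>y. y \<in> V \<Longrightarrow> K' y = inv (blinfun_apply (f' (K y)))"
    "\<And>y. y \<in> V \<Longrightarrow> bij (blinfun_apply (f' (K y)))" by metis
  have bij: "bij_betw F U V"
    using UV(5) by (intro bij_betwI[of F U V K]) (auto simp: homeomorphism_def)
  have K_eq: "K y = inv_into U F y" if "y \<in> V" for y
    using UV(5) that bij inv_into_f_eq[of F U "K y" y] unfolding homeomorphism_def bij_betw_def by auto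
  have bl: "blinfun_apply (Blinfun (K' y)) = K' y" if "y \<in> V" for y
    using UV(6)[OF that] has_derivative_bounded_linear bounded_linear_Blinfun_apply by blast
  have KV: "K y \<in> W" if "y \<in> V" for y
    using UV(2,5) that unfolding homeomorphism_def by blast
  have "continuous_on V (\<lambda>y. Blinfun (K' y))"
  proof (rule continuous_on_inverse_blinfun[where A = "\<lambda>y. f' (K y)"])
    show "continuous_on V (\<lambda>y. f' (K y))"
      using UV(2,5)
      by (intro continuous_on_compose2[OF f'(2), of V K]) (auto simp: homeomorphism_def)
  next
    fix y assume y: "y \<in> V"
    show "f' (K y) o\<^sub>L Blinfun (K' y) = id_blinfun"
      by (rule blinfun_eqI) (simp add: bl[OF y], simp add: UV(7)[OF y] bij_is_surj[OF UV(8)[OF y]] surj_f_inv_f)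
    show "Blinfun (K' y) o\<^sub>L f' (K y) = id_blinfun"
      by (rule blinfun_eqI) (simp add: bl[OF y], simp add: UV(7)[OF y] bij_is_inj[OF UV(8)[OF y]])
  qed
  then have "C1_on V K"
    unfolding C1_on_def using UV(6) bl by (intro exI[of _ "\<lambda>y. Blinfun (K' y)"]) auto
  then have "C1_on V (inv_into U F)" using C1_on_cong UV(4) K_eq by blast
  then show ?thesis using that UV bij by blast
qed

subsection \<open>Splitting off one variable\<close>

text \<open>The second difference \<open>\<Delta> v w t\<close> is symmetric in \<open>v\<close> and
  \<open>w\<close>. Divided by \<open>t\<^sup>2\<close> it tends to \<open>H w \<bullet> v\<close>,
  by the mean value theorem in direction \<open>v\<close> and differentiability of \<open>G\<close>
  at \<open>z\<close>; exchanging \<open>v\<close> and \<open>w\<close> leaves the limit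
  unchanged.\<close>

lemma gradient_derivative_symmetric:
  fixes g :: "'a::euclidean_space \<Rightarrow> real"
  assumes W: "open W" "z \<in> W"
    and grad: "\<And>x. x \<in> W \<Longrightarrow> (g has_derivative (\<lambda>v. G x \<bullet> v)) (at x)"
    and H: "(G has_derivative H) (at z)"
  shows "H v \<bullet> w = H w \<bullet> v"
proof -
  have linH: "linear H" using H has_derivative_linear by blast
  define \<Delta> where "\<Delta> v w t = g (z + t *\<^sub>R v + t *\<^sub>R w) - g (z + t *\<^sub>R v) - g (z + t *\<^sub>R w) + g z"
    for v w and t :: real
  have lim: "((\<lambda>t. \<Delta> v w t / t\<^sup>2) \<longlongrightarrow> H w \<bullet> v) (at_right 0)" for v w
  proof (rule tendstoI)
    fix e :: real assume e: "e > 0"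
    \<comment> \<open>\<open>t * M\<close> bounds the displacements from \<open>z\<close> that
      occur. With \<open>\<epsilon>\<close> below, two linearization errors of size
      \<open>\<epsilon> * (t * M)\<close>, paired with \<open>t *\<^sub>R v\<close>, add up to at
      most \<open>t\<^sup>2 * (e / 2)\<close>.\<close>
    define M where "M = norm v + norm w + 1"
    have M: "M \<ge> 1" "norm v \<le> M" "norm v + norm w \<le> M" by (auto simp: M_def)
    define \<epsilon> where "\<epsilon> = e / (4 * M * M)"
    have \<epsilon>: "\<epsilon> > 0" using e M by (simp add: \<epsilon>_def)
    obtain d1 where d1: "d1 > 0" "\<And>x. norm (x - z) < d1 \<Longrightarrow> norm (G x - G z - H (x - z)) \<le> \<epsilon> * norm (x - z)"
      using H \<epsilon> unfolding has_derivative_at_alt by blast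
    obtain d2 where d2: "d2 > 0" "ball z d2 \<subseteq> W" using W open_contains_ball by blast
    define t0 where "t0 = min d1 d2 / M"
    have t0: "t0 > 0" using d1 d2 M by (simp add: t0_def)
    have "dist (\<Delta> v w t / t\<^sup>2) (H w \<bullet> v) < e" if t: "0 < t" "t < t0" for t
    proof -
      have tM: "t * M < d1" "t * M < d2" using t M by (auto simp: t0_def field_simps)
      have small: "norm (s *\<^sub>R t *\<^sub>R v + r *\<^sub>R t *\<^sub>R w) \<le> t * M" if "0 \<le> s" "s \<le> 1" "0 \<le> r" "r \<le> 1" for s r
      proof -
        have "norm (s *\<^sub>R t *\<^sub>R v + r *\<^sub>R t *\<^sub>R w) \<le> s * (t * norm v) + r * (t * norm w)"
          using norm_triangle_ineq[of "s *\<^sub>R t *\<^sub>R v" "r *\<^sub>R t *\<^sub>R w"] that t by simp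
        also have "\<dots> \<le> 1 * (t * norm v) + 1 * (t * norm w)"
          using that t by (intro add_mono mult_right_mono) auto
        also have "\<dots> \<le> t * M" using t M(3) by (simp add: distrib_left[symmetric])
        finally show ?thesis .
      qed
      have inW: "z + s *\<^sub>R t *\<^sub>R v + r *\<^sub>R t *\<^sub>R w \<in> W" if "0 \<le> s" "s \<le> 1" "0 \<le> r" "r \<le> 1" for s r
        using small[OF that] tM d2(2) by (auto simp: dist_norm add.assoc subset_iff)
          (metis add_diff_cancel_left' dist_norm dist_commute le_less_trans mem_ball)
      \<comment> \<open>\<open>\<phi> 1 - \<phi> 0\<close> is the second difference. The formal
        factors 1 and 0 keep both points in the shape covered by \<open>small\<close> and
        \<open>inW\<close>.\<close>
      define \<phi> where "\<phi> s = g (z + s *\<^sub>R t *\<^sub>R v + 1 *\<^sub>R t *\<^sub>R w) - g (z + s *\<^sub>R t *\<^sub>R v + 0 *\<^sub>R t *\<^sub>R w)" for s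
      have der: "(\<phi> has_derivative
          (\<lambda>h. h * ((G (z + s *\<^sub>R t *\<^sub>R v + 1 *\<^sub>R t *\<^sub>R w) - G (z + s *\<^sub>R t *\<^sub>R v + 0 *\<^sub>R t *\<^sub>R w)) \<bullet> (t *\<^sub>R v)))) (at s)"
        if "0 \<le> s" "s \<le> 1" for s
      proof -
        have "((\<lambda>s. g (z + s *\<^sub>R t *\<^sub>R v + r *\<^sub>R t *\<^sub>R w)) has_derivative
          (\<lambda>h. G (z + s *\<^sub>R t *\<^sub>R v + r *\<^sub>R t *\<^sub>R w) \<bullet> (h *\<^sub>R t *\<^sub>R v))) (at s)" if "0 \<le> r" "r \<le> 1" for r
          by (rule has_derivative_compose[OF _ grad]) (use inW[OF \<open>0 \<le> s\<close> \<open>s \<le> 1\<close> that] in \<open>auto intro!: derivative_eq_intros\<close>)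
        from has_derivative_diff[OF this[of 1] this[of 0]] show ?thesis
          unfolding \<phi>_def by (simp add: algebra_simps inner_diff_left)
      qed
      obtain s where s: "0 < s" "s < 1" "\<phi> 1 - \<phi> 0 =
        (G (z + s *\<^sub>R t *\<^sub>R v + 1 *\<^sub>R t *\<^sub>R w) - G (z + s *\<^sub>R t *\<^sub>R v + 0 *\<^sub>R t *\<^sub>R w)) \<bullet> (t *\<^sub>R v)"
        using mvt_simple[of 0 1 \<phi>, OF _ has_derivative_at_withinI[OF der]] by auto
      define a where "a = s *\<^sub>R t *\<^sub>R v + 1 *\<^sub>R t *\<^sub>R w"
      define b where "b = s *\<^sub>R t *\<^sub>R v + 0 *\<^sub>R t *\<^sub>R w"
      have n: "norm a \<le> t * M" "norm b \<le> t * M" using s small[of s 1] small[of s 0] by (auto simp: a_def b_def)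
      have ra: "norm (G (z + a) - G z - H a) \<le> \<epsilon> * (t * M)"
        using d1(2)[of "z + a"] n(1) tM \<epsilon> by (simp add: mult_left_mono order_trans)
      have rb: "norm (G (z + b) - G z - H b) \<le> \<epsilon> * (t * M)"
        using d1(2)[of "z + b"] n(2) tM \<epsilon> by (simp add: mult_left_mono order_trans)
      \<comment> \<open>The points \<open>a\<close> and \<open>b\<close> have the same
        \<open>v\<close> part, so linearizing \<open>G\<close> at \<open>z\<close> leaves only the
        contribution of \<open>t *\<^sub>R w\<close>.\<close>
      have "H a - H b = t *\<^sub>R H w"
        by (simp add: a_def b_def linear_diff[OF linH, symmetric] linear_cmul[OF linH, symmetric])
      then have eq: "G (z + a) - G (z + b) - t *\<^sub>R H w = (G (z + a) - G z - H a) - (G (z + b) - G z - H b)"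
        by (simp add: algebra_simps)
      have nr: "norm (G (z + a) - G (z + b) - t *\<^sub>R H w) \<le> 2 * \<epsilon> * (t * M)"
        unfolding eq
        using norm_triangle_ineq4[of "G (z + a) - G z - H a" "G (z + b) - G z - H b"] ra rb by (simp add: mult.assoc)
      have "\<Delta> v w t = (G (z + a) - G (z + b)) \<bullet> (t *\<^sub>R v)"
        using s(3) by (simp add: \<Delta>_def \<phi>_def a_def b_def algebra_simps)
      then have "\<Delta> v w t - t\<^sup>2 * (H w \<bullet> v) = t * ((G (z + a) - G (z + b) - t *\<^sub>R H w) \<bullet> v)"
        by (simp add: inner_diff_left power2_eq_square algebra_simps)
      then have "\<bar>\<Delta> v w t - t\<^sup>2 * (H w \<bullet> v)\<bar> = t * \<bar>(G (z + a) - G (z + b) - t *\<^sub>R H w) \<bullet> v\<bar>"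
        using t by (simp add: abs_mult)
      also have "\<dots> \<le> t * ((2 * \<epsilon> * (t * M)) * M)"
        using t M nr \<epsilon> by (intro mult_left_mono order_trans[OF Cauchy_Schwarz_ineq2] mult_mono) auto
      also have "\<dots> = t\<^sup>2 * (e / 2)" using M by (simp add: \<epsilon>_def power2_eq_square field_simps)
      finally have *: "\<bar>\<Delta> v w t - t\<^sup>2 * (H w \<bullet> v)\<bar> \<le> t\<^sup>2 * (e / 2)" .
      have "\<Delta> v w t / t\<^sup>2 - H w \<bullet> v = (\<Delta> v w t - t\<^sup>2 * (H w \<bullet> v)) / t\<^sup>2"
        using t by (simp add: field_simps)
      then have "\<bar>\<Delta> v w t / t\<^sup>2 - H w \<bullet> v\<bar> \<le> e / 2"
        using * t by (simp add: abs_divide field_simps)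
      then show ?thesis using e by (simp add: dist_real_def)
    qed
    then show "\<forall>\<^sub>F t in at_right 0. dist (\<Delta> v w t / t\<^sup>2) (H w \<bullet> v) < e"
      unfolding eventually_at_right_field using t0 by blast
  qed
  have "\<Delta> v w = \<Delta> w v" by (auto simp: \<Delta>_def algebra_simps)
  then show ?thesis
    using tendsto_unique[OF _ lim[of v w] lim[of w v, folded \<open>\<Delta> v w = \<Delta> w v\<close>]] by simp
qed

section \<open>Products and signed roots with little regularity\<close>

lemma open_Collect_greater_on:
  fixes f :: "'a::topological_space \<Rightarrow> real"
  assumes "open S" "continuous_on S f"
  shows "open {x \<in> S. c < f x}"
proof -
  have "{x \<in> S. c < f x} = S \<inter> f -` {c<..}" by auto
  then show ?thesis using assms by (simp add: continuous_open_preimage)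
qed

text \<open>At a zero of \<open>v\<close> the product rule has no term with the derivative of
  \<open>s\<close>, so continuity of \<open>s\<close> suffices: the remainder is that of
  \<open>v\<close> times \<open>s y\<close>, plus \<open>D (y - x) * (s y - s x)\<close>, whose
  first factor is of order \<open>norm (y - x)\<close> and whose second tends to 0.\<close>

lemma has_derivative_mult_vanishing:
  fixes v s :: "'a::real_normed_vector \<Rightarrow> real"
  assumes v: "(v has_derivative D) (at x)" and "v x = 0" and s: "isCont s x"
  shows "((\<lambda>y. v y * s y) has_derivative (\<lambda>w. D w * s x)) (at x)"
proof -
  have bl: "bounded_linear D" using v has_derivative_bounded_linear by blast
  then obtain K where K: "\<And>w. norm (D w) \<le> norm w * K" using bounded_linear.bounded by blast
  have 1: "((\<lambda>y. (1 / norm (y - x)) *\<^sub>R (v y - (v x + D (y - x)))) \<longlongrightarrow> 0) (at x)"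
    using v unfolding has_derivative_at2 by blast
  have s': "(s \<longlongrightarrow> s x) (at x)" using s by (simp add: isCont_def)
  have 2: "((\<lambda>y. (1 / norm (y - x)) * D (y - x) * (s y - s x)) \<longlongrightarrow> 0) (at x)"
  proof (rule Lim_null_comparison)
    show "\<forall>\<^sub>F y in at x. norm ((1 / norm (y - x)) * D (y - x) * (s y - s x)) \<le> K * norm (s y - s x)"
    proof (rule eventually_mono[OF eventually_neq_at_within[of x x UNIV]])
      fix y assume "y \<noteq> x"
      then have "norm ((1 / norm (y - x)) * D (y - x)) \<le> K"
        using K[of "y - x"] by (simp add: abs_mult field_simps)
      then show "norm ((1 / norm (y - x)) * D (y - x) * (s y - s x)) \<le> K * norm (s y - s x)"
        by (metis norm_mult norm_ge_zero mult_right_mono)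
    qed
    show "((\<lambda>y. K * norm (s y - s x)) \<longlongrightarrow> 0) (at x)"
      using LIM_zero[OF s'] by (intro tendsto_mult_right_zero tendsto_norm_zero)
  qed
  have "((\<lambda>y. ((1 / norm (y - x)) *\<^sub>R (v y - (v x + D (y - x)))) * s y
      + (1 / norm (y - x)) * D (y - x) * (s y - s x)) \<longlongrightarrow> 0 * s x + 0) (at x)"
    by (intro tendsto_add tendsto_mult 1 2 s')
  moreover have "(k *\<^sub>R (v y - (v x + D (y - x)))) * s y + k * D (y - x) * (s y - s x)
      = k *\<^sub>R (v y * s y - (v x * s x + D (y - x) * s x))" for k y
    using \<open>v x = 0\<close> by (simp add: algebra_simps)
  ultimately have "((\<lambda>y. (1 / norm (y - x)) *\<^sub>R (v y * s y - (v x * s x + D (y - x) * s x))) \<longlongrightarrow> 0) (at x)"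
    by (simp only: mult_zero_left add_0_right)
  moreover have "bounded_linear (\<lambda>w. D w * s x)"
    using bl by (intro bounded_linear_mult_const)
  ultimately show ?thesis unfolding has_derivative_at2 by blast
qed

text \<open>The derivative \<open>B / (2 \<surd>a)\<close> is that of \<open>sgn v \<surd>P\<close> where \<open>v \<noteq> 0\<close>, and \<open>\<surd>a Dv\<close> where
  \<open>v = 0\<close>; the condition on \<open>B\<close> makes the two agree, although \<open>a\<close> itself need not be differentiable.\<close>

lemma signed_sqrt:
  fixes v a P :: "'a::euclidean_space \<Rightarrow> real" and B :: "'a \<Rightarrow> 'a"
  assumes S: "open S"
    and v: "\<And>x. x \<in> S \<Longrightarrow> (v has_derivative Dv x) (at x)"
    and P: "\<And>x. x \<in> S \<Longrightarrow> (P has_derivative (\<lambda>w. v x * (B x \<bullet> w))) (at x)"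
    and P_eq: "\<And>x. x \<in> S \<Longrightarrow> P x = (v x)\<^sup>2 * a x"
    and a: "\<And>x. x \<in> S \<Longrightarrow> a x > 0" "continuous_on S a"
    and B: "continuous_on S B" "\<And>x w. x \<in> S \<Longrightarrow> v x = 0 \<Longrightarrow> B x \<bullet> w = 2 * a x * Dv x w"
  shows "x \<in> S \<Longrightarrow> ((\<lambda>x. v x * sqrt (a x)) has_derivative (\<lambda>w. (B x \<bullet> w) / (2 * sqrt (a x)))) (at x)"
    and "C1_on S (\<lambda>x. v x * sqrt (a x))"
proof -
  show der: "((\<lambda>x. v x * sqrt (a x)) has_derivative (\<lambda>w. (B x \<bullet> w) / (2 * sqrt (a x)))) (at x)"
    if x: "x \<in> S" for x
  proof (cases "v x = 0")
    case True
    have "isCont (\<lambda>x. sqrt (a x)) x"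
      using a(2) S x by (auto simp: continuous_on_eq_continuous_at intro!: continuous_intros)
    from has_derivative_mult_vanishing[OF v[OF x] True this]
    have "((\<lambda>x. v x * sqrt (a x)) has_derivative (\<lambda>w. Dv x w * sqrt (a x))) (at x)" .
    moreover have "Dv x w * sqrt (a x) = (B x \<bullet> w) / (2 * sqrt (a x))" for w
      using B(2)[OF x True, of w] a(1)[OF x] real_sqrt_mult_self[of "a x"] by (simp add: field_simps)
    ultimately show ?thesis by simp
  next
    case False
    \<comment> \<open>Near \<open>x\<close> the sign of \<open>v\<close> is constant, so
      \<open>v y * sqrt (a y)\<close> equals \<open>sgn (v x) * sqrt (P y)\<close>. This moves the
      differentiation from \<open>a\<close> to \<open>P\<close>.\<close>
    define T where "T = {y \<in> S. v y * v x > 0}"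
    have "continuous_on S v" using v continuous_at_imp_continuous_on has_derivative_continuous by blast
    then have "continuous_on S (\<lambda>y. v y * v x)" by (intro continuous_intros)
    then have "open T"
      unfolding T_def by (rule open_Collect_greater_on[OF S])
    have "x \<in> T" using x False by (auto simp: T_def zero_less_mult_iff)
    have P0: "P x > 0" using P_eq[OF x] a(1)[OF x] False by simp
    have "((\<lambda>y. sgn (v x) * sqrt (P y)) has_derivative
        (\<lambda>w. sgn (v x) * (v x * (B x \<bullet> w) * (inverse (sqrt (P x)) / 2)))) (at x)"
      by (intro has_derivative_mult_right has_derivative_real_sqrt P0 P x)
    moreover have "sgn (v x) * sqrt (P y) = v y * sqrt (a y)" if "y \<in> T" for y
    proof -
      have "sgn (v x) = sgn (v y)"
        using that by (auto simp: T_def zero_less_mult_iff)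
      then show ?thesis
        using that P_eq[of y] by (simp add: T_def real_sqrt_mult real_sqrt_abs mult_sgn_abs flip: mult.assoc)
    qed
    ultimately have "((\<lambda>y. v y * sqrt (a y)) has_derivative
        (\<lambda>w. sgn (v x) * (v x * (B x \<bullet> w) * (inverse (sqrt (P x)) / 2)))) (at x)"
      by (rule has_derivative_transform_within_open[OF _ \<open>open T\<close> \<open>x \<in> T\<close>])
    moreover have "sgn (v x) * (v x * (B x \<bullet> w) * (inverse (sqrt (P x)) / 2)) = (B x \<bullet> w) / (2 * sqrt (a x))" for w
      using False by (simp add: P_eq[OF x] real_sqrt_mult real_sqrt_abs sgn_if field_simps)
    ultimately show ?thesis by (simp only:)
  qed
  show "C1_on S (\<lambda>x. v x * sqrt (a x))"
    by (rule C1_onI[OF der]) (use a(2) in \<open>auto intro!: continuous_intros B(1) dest: a(1)\<close>)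
qed

definition zero_coord :: "'n \<Rightarrow> real^'n \<Rightarrow> real^'n" where
  "zero_coord u z = z - (z $ u) *\<^sub>R axis u 1"

lemma zero_coord_nth: "zero_coord u z $ i = (if i = u then 0 else z $ i)"
  by (simp add: zero_coord_def axis_def)

lemma zero_coord_idem [simp]: "zero_coord u (zero_coord u z) = zero_coord u z"
  by (simp add: vec_eq_iff zero_coord_nth)

lemma bounded_linear_zero_coord: "bounded_linear (zero_coord u)"
  unfolding zero_coord_def
  by (intro bounded_linear_sub bounded_linear_ident bounded_linear_scaleR_const bounded_linear_vec_nth)

lemma zero_coord_add: "zero_coord u z + (z $ u) *\<^sub>R axis u 1 = z"
  by (simp add: zero_coord_def)

text \<open>\<open>\<pi> z\<close> is the critical point of \<open>g\<close> near \<open>0\<close> on the line through \<open>z\<close> in direction \<open>u\<close>. In the proof,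
  \<open>v\<close> is the offset of \<open>z\<close> from it, and \<open>v\<^sup>2 a\<close> and \<open>v B\<close> are the integral remainders of \<open>g\<close> and of its
  gradient along the segment from \<open>\<pi> z\<close> to \<open>z\<close>. Symmetry of the second derivative gives the condition on
  \<open>B\<close> at \<open>v = 0\<close>.\<close>

lemma split_variable:
  fixes g :: "real^'n \<Rightarrow> real" and G :: "real^'n \<Rightarrow> real^'n"
  assumes W: "open W" "0 \<in> W"
    and grad: "\<And>x. x \<in> W \<Longrightarrow> (g has_derivative (\<lambda>v. G x \<bullet> v)) (at x)"
    and C1: "C1_on W G"
    and H: "(G has_derivative H) (at 0)"
    and crit: "G 0 $ u = 0"
    and d: "H (axis u 1) $ u = d" "d \<noteq> 0"
  obtains N \<pi> D\<pi> y c where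
    "open N" "0 \<in> N" "N \<subseteq> W"
    "C1_on N \<pi>" "\<pi> ` N \<subseteq> W" "\<pi> 0 = 0" "(\<pi> has_derivative D\<pi>) (at 0)"
    "\<And>z. \<pi> (zero_coord u z) = \<pi> z"
    "\<And>w. D\<pi> w = zero_coord u w - (H (zero_coord u w) $ u / d) *\<^sub>R axis u 1"
    "\<And>z. z \<in> N \<Longrightarrow> ((\<lambda>z. g (\<pi> z)) has_derivative (\<lambda>v. G (\<pi> z) \<bullet> v)) (at z)"
    "\<And>z. z \<in> N \<Longrightarrow> g z = g (\<pi> z) + sgn d * (y z)\<^sup>2"
    "C1_on N y" "y 0 = 0" "(y has_derivative (\<lambda>w. c * (w $ u - D\<pi> w $ u))) (at 0)" "c \<noteq> 0"
proof -
  define e :: "real^'n" where "e = axis u 1"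
  define Z :: "real^'n \<Rightarrow> real^'n" where "Z = zero_coord u"
  have Z_nth: "Z z $ i = (if i = u then 0 else z $ i)" for z i
    by (simp add: Z_def zero_coord_nth)
  have e_nth: "e $ i = (if i = u then 1 else 0)" for i by (simp add: e_def axis_def)
  have Z_add: "Z z + (z $ u) *\<^sub>R e = z" for z
    unfolding Z_def e_def by (simp add: zero_coord_add)
  have inner_e: "x \<bullet> e = x $ u" for x :: "real^'n" by (simp add: e_def inner_axis)
  have blZ: "bounded_linear Z" unfolding Z_def by (rule bounded_linear_zero_coord)
  have blu: "bounded_linear (\<lambda>x::real^'n. x $ u)" by (rule bounded_linear_vec_nth)
  have linH: "linear H" using H has_derivative_linear by blast
  \<comment> \<open>A ball is convex, so the segments from \<open>\<pi> z\<close> to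
    \<open>z\<close> used for the remainders stay in the domain of \<open>G'\<close>.\<close>
  obtain r where r: "r > 0" "ball 0 r \<subseteq> W" using W open_contains_ball by blast
  define W' where "W' = ball (0::real^'n) r"
  have W': "open W'" "0 \<in> W'" "W' \<subseteq> W" "convex W'" using r by (auto simp: W'_def)
  obtain G' where G': "\<And>x. x \<in> W' \<Longrightarrow> (G has_derivative blinfun_apply (G' x)) (at x)" "continuous_on W' G'"
    using C1_on_subset[OF C1 W'(3)] unfolding C1_on_def by auto
  have H_eq: "H = blinfun_apply (G' 0)"
    using has_derivative_unique[OF H G'(1)] W' by auto
  have sym: "G' z v \<bullet> w = G' z w \<bullet> v" if "z \<in> W'" for z v w
    using gradient_derivative_symmetric[OF W'(1) that _ G'(1)[OF that]] grad W'(3) by blast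

  \<comment> \<open>The implicit function theorem by inversion: \<open>F\<close> replaces the
    coordinate \<open>u\<close> by the partial derivative of \<open>g\<close> in that direction. Its
    derivative at 0 is injective because a kernel vector is a multiple of \<open>e\<close>, and
    \<open>d \<noteq> 0\<close>.\<close>
  define F where "F x = Z x + (G x $ u) *\<^sub>R e" for x
  have "C1_on W' F"
    unfolding F_def
    by (intro C1_on_add C1_on_bounded_linear[OF blZ]
        C1_on_linear_compose[OF bounded_linear_scaleR_const[OF blu]] C1_on_subset[OF C1 W'(3)])
  moreover have "(F has_derivative (\<lambda>v. Z v + (H v $ u) *\<^sub>R e)) (at 0)"
    unfolding F_def
    by (intro has_derivative_add bounded_linear_imp_has_derivative blZ has_derivative_scaleR_left
        bounded_linear.has_derivative[OF blu] H)
  moreover have "v = 0" if v: "Z v + (H v $ u) *\<^sub>R e = 0" for v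
  proof -
    have *: "Z v $ i + (H v $ u) * e $ i = 0" for i
      using arg_cong[OF v, of "\<lambda>x. x $ i"] by simp
    have "H v $ u = 0" using *[of u] by (simp add: Z_nth e_nth)
    moreover have "v $ i = 0" if "i \<noteq> u" for i using *[of i] that by (simp add: Z_nth e_nth)
    ultimately have "Z v = 0" by (simp add: vec_eq_iff Z_nth)
    then have ve: "(v $ u) *\<^sub>R e = v" using Z_add[of v] by simp
    have "H v $ u = v $ u * d"
      using linear_cmul[OF linH, of "v $ u" e] d unfolding ve by (simp add: e_def)
    then have "v $ u = 0" using \<open>H v $ u = 0\<close> d by simp
    then show ?thesis using ve by simp
  qed
  ultimately obtain U V where UV: "open U" "0 \<in> U" "U \<subseteq> W'" "open V" "bij_betw F U V" "C1_on V (inv_into U F)"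
    by (rule C1_inverse_function[OF W'(1,2)])
  have Z0: "Z 0 = 0" by (simp add: vec_eq_iff Z_nth)
  have F0: "F 0 = 0" by (simp add: F_def crit Z0)
  have V0: "0 \<in> V" using F0 UV(2,5) bij_betwE by force
  \<comment> \<open>\<open>Z z\<close> has \<open>u\<close>-coordinate 0, so a preimage under
    \<open>F\<close> is critical in direction \<open>u\<close> and shares its other coordinates with
    \<open>z\<close>. As \<open>\<pi>\<close> sees \<open>z\<close> only through \<open>Z z\<close>,
    it is constant along \<open>u\<close>.\<close>
  define \<pi> where "\<pi> z = inv_into U F (Z z)" for z
  have \<pi>0: "\<pi> 0 = 0"
    unfolding \<pi>_def Z0 using UV(2,5) F0 by (metis bij_betw_imp_inj_on inv_into_f_f)
  define N0 where "N0 = W' \<inter> Z -` V"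
  have "continuous_on UNIV Z" using blZ by (simp add: linear_continuous_on)
  then have N0: "open N0" "0 \<in> N0" "N0 \<subseteq> W'" unfolding N0_def
    using UV(4) W' V0 Z0 open_vimage by (auto intro!: open_Int)
  have \<pi>U: "\<pi> z \<in> U" and F\<pi>: "F (\<pi> z) = Z z" if "z \<in> N0" for z
    using that UV(5) unfolding \<pi>_def N0_def bij_betw_def
    by (auto intro: inv_into_into f_inv_into_f)
  have \<pi>W: "\<pi> z \<in> W'" if "z \<in> N0" for z using \<pi>U[OF that] UV(3) by auto
  have Z\<pi>: "Z (\<pi> z) = Z z" and G\<pi>: "G (\<pi> z) $ u = 0" if "z \<in> N0" for z
  proof -
    have *: "Z (\<pi> z) $ i + (G (\<pi> z) $ u) * e $ i = Z z $ i" for i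
      using arg_cong[OF F\<pi>[OF that], of "\<lambda>x. x $ i"] by (simp add: F_def)
    show "G (\<pi> z) $ u = 0" using *[of u] by (simp add: Z_nth e_nth)
    then show "Z (\<pi> z) = Z z" using F\<pi>[OF that] by (simp add: F_def)
  qed
  have C1\<pi>: "C1_on N0 \<pi>"
    unfolding \<pi>_def by (rule C1_on_compose[OF UV(6) C1_on_bounded_linear[OF blZ]]) (auto simp: N0_def)
  then obtain \<pi>' where \<pi>': "\<And>x. x \<in> N0 \<Longrightarrow> (\<pi> has_derivative blinfun_apply (\<pi>' x)) (at x)" "continuous_on N0 \<pi>'"
    unfolding C1_on_def by auto
  have cont\<pi>: "continuous_on N0 \<pi>" by (rule C1_on_imp_continuous_on[OF C1\<pi>])
  have Z\<pi>': "Z (\<pi>' z w) = Z w" if z: "z \<in> N0" for z w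
  proof -
    have "((\<lambda>z. Z (\<pi> z)) has_derivative (\<lambda>w. Z (\<pi>' z w))) (at z)"
      by (rule bounded_linear.has_derivative[OF blZ \<pi>'(1)[OF z]])
    then have "(Z has_derivative (\<lambda>w. Z (\<pi>' z w))) (at z)"
      by (rule has_derivative_transform_within_open[OF _ N0(1) z Z\<pi>])
    then show ?thesis
      using has_derivative_unique[OF bounded_linear_imp_has_derivative[OF blZ]] by metis
  qed
  \<comment> \<open>This differentiates the identity \<open>G\<pi>\<close>. It later determines
    \<open>\<pi>'\<close> at 0 and supplies the cancellation in \<open>B_eq\<close>.\<close>
  have G\<pi>': "G' (\<pi> z) (\<pi>' z w) $ u = 0" if z: "z \<in> N0" for z w
  proof -
    have "((\<lambda>z. G (\<pi> z) $ u) has_derivative (\<lambda>w. G' (\<pi> z) (\<pi>' z w) $ u)) (at z)"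
      by (intro bounded_linear.has_derivative[OF blu] has_derivative_compose[OF \<pi>'(1)[OF z]] G' \<pi>W z)
    then have "((\<lambda>z. 0) has_derivative (\<lambda>w. G' (\<pi> z) (\<pi>' z w) $ u)) (at z)"
      by (rule has_derivative_transform_within_open[OF _ N0(1) z G\<pi>])
    then show ?thesis
      using has_derivative_unique[OF has_derivative_const] by metis
  qed
  have \<pi>'_eq: "\<pi>' z w = Z w + (\<pi>' z w $ u) *\<^sub>R e" if "z \<in> N0" for z w
    using Z_add[of "\<pi>' z w", symmetric] unfolding Z\<pi>'[OF that, of w] .

  \<comment> \<open>Integral remainders along the segment to the critical point\<close>
  define v where "v z = z $ u - \<pi> z $ u" for z
  have z_eq: "\<pi> z + v z *\<^sub>R e = z" if "z \<in> N0" for z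
  proof -
    have "(z $ u) *\<^sub>R e = (\<pi> z $ u) *\<^sub>R e + v z *\<^sub>R e"
      by (simp add: v_def flip: scaleR_left_distrib)
    then show ?thesis
      using Z_add[of z] Z_add[of "\<pi> z"] Z\<pi>[OF that] by (metis add.assoc)
  qed
  define c where "c z t = \<pi> z + (t * v z) *\<^sub>R e" for z t
  have cW: "c z t \<in> W'" if z: "z \<in> N0" and t: "t \<in> {0..1}" for z t
  proof -
    have "c z t = (1 - t) *\<^sub>R \<pi> z + t *\<^sub>R (\<pi> z + v z *\<^sub>R e)" by (simp add: c_def algebra_simps)
    also have "\<dots> = (1 - t) *\<^sub>R \<pi> z + t *\<^sub>R z" using z_eq[OF z] by simp
    finally show ?thesis
      using convexD_alt[OF W'(4) \<pi>W[OF z], of z t] N0(3) z t by auto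
  qed
  define a where "a z = integral {0..1} (\<lambda>t. (1 - t) * (G' (c z t) e $ u))" for z
  define B where "B z = integral {0..1} (\<lambda>t. G' (c z t) e)" for z
  have cont_v: "continuous_on N0 v" unfolding v_def by (intro continuous_intros cont\<pi>)
  have cont_c: "continuous_on (N0 \<times> {0..1}) (\<lambda>p. c (fst p) (snd p))"
    unfolding c_def
    by (intro continuous_intros continuous_on_compose2[OF cont\<pi>] continuous_on_compose2[OF cont_v]) auto
  have cont_G': "continuous_on (N0 \<times> {0..1}) (\<lambda>p. G' (c (fst p) (snd p)))"
    by (rule continuous_on_compose2[OF G'(2) cont_c]) (auto simp: cW)
  have cont_a: "continuous_on N0 a"
    unfolding a_def cbox_interval[symmetric]
    by (rule integral_continuous_on_param)
      (simp add: split_beta cbox_interval, intro continuous_intros cont_G')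
  have cont_B: "continuous_on N0 B"
    unfolding B_def cbox_interval[symmetric]
    by (rule integral_continuous_on_param)
      (simp add: split_beta cbox_interval, intro continuous_intros cont_G')
  have c01: "c z 0 = \<pi> z" "c z 1 = z" if "z \<in> N0" for z
    using z_eq[OF that] by (auto simp: c_def)
  have c_der: "((\<lambda>t. c z t) has_vector_derivative v z *\<^sub>R e) (at t within {0..1})" for z t
    unfolding c_def by (auto intro!: derivative_eq_intros)
  have G_der: "((\<lambda>t. G (c z t)) has_vector_derivative v z *\<^sub>R G' (c z t) e) (at t within {0..1})"
    if "z \<in> N0" "t \<in> {0..1}" for z t
    using vector_derivative_diff_chain_within[OF c_der
        has_derivative_at_withinI[OF G'(1)[OF cW[OF that]]]]
    by (simp add: o_def blinfun.scaleR_right)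
  have g_der: "((\<lambda>t. g (c z t)) has_vector_derivative v z * G (c z t) $ u) (at t within {0..1})"
    if "z \<in> N0" "t \<in> {0..1}" for z t
    using vector_derivative_diff_chain_within[OF c_der
        has_derivative_at_withinI[OF grad[OF subsetD[OF W'(3) cW[OF that]]]]]
    by (simp add: o_def inner_e)
  have G_diff: "G z - G (\<pi> z) = v z *\<^sub>R B z" if z: "z \<in> N0" for z
  proof -
    have "((\<lambda>t. v z *\<^sub>R G' (c z t) e) has_integral (G (c z 1) - G (c z 0))) {0..1}"
      by (rule fundamental_theorem_of_calculus) (auto intro: G_der z)
    then show ?thesis
      using z by (simp add: B_def c01 integral_unique flip: integral_cmul)
  qed
  have g_diff: "g z - g (\<pi> z) = (v z)\<^sup>2 * a z" if z: "z \<in> N0" for z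
  proof -
    \<comment> \<open>Taylor's formula of second order: this antiderivative stands in for
      integration by parts. Its first summand vanishes at \<open>t = 1\<close> through the factor
      \<open>1 - t\<close>, and at \<open>t = 0\<close> because \<open>\<pi> z\<close> is critical
      in direction \<open>u\<close>.\<close>
    have "((\<lambda>t. (1 - t) * (v z * G (c z t) $ u) + g (c z t)) has_vector_derivative
        (v z)\<^sup>2 * ((1 - t) * (G' (c z t) e $ u))) (at t within {0..1})" if "t \<in> {0..1}" for t
    proof -
      have "((\<lambda>t. G (c z t) $ u) has_vector_derivative v z * G' (c z t) e $ u) (at t within {0..1})"
        using bounded_linear.has_vector_derivative[OF blu G_der[OF z that]] by simp
      then show ?thesis
        using g_der[OF z that] unfolding has_real_derivative_iff_has_vector_derivative[symmetric]
        by (auto intro!: derivative_eq_intros simp: power2_eq_square algebra_simps)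
    qed
    then have "((\<lambda>t. (v z)\<^sup>2 * ((1 - t) * (G' (c z t) e $ u))) has_integral
        (((1 - 1) * (v z * G (c z 1) $ u) + g (c z 1)) - ((1 - 0) * (v z * G (c z 0) $ u) + g (c z 0)))) {0..1}"
      by (intro fundamental_theorem_of_calculus) auto
    from integral_unique[OF this] show ?thesis
      using z by (simp add: a_def c01 G\<pi>)
  qed
  have g\<pi>_der: "((\<lambda>z. g (\<pi> z)) has_derivative (\<lambda>w. G (\<pi> z) \<bullet> w)) (at z)" if z: "z \<in> N0" for z
  proof -
    have "((\<lambda>z. g (\<pi> z)) has_derivative (\<lambda>w. G (\<pi> z) \<bullet> \<pi>' z w)) (at z)"
      by (intro has_derivative_compose[OF \<pi>'(1)[OF z]] grad subsetD[OF W'(3)] \<pi>W z)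
    \<comment> \<open>\<open>\<pi>' z w\<close> and \<open>w\<close> differ by a multiple of
      \<open>e\<close>, which \<open>G (\<pi> z)\<close> annihilates. Thus \<open>\<pi>'\<close>
      drops out of the gradient of the reduced function, which is therefore C^1 again.\<close>
    moreover have "G (\<pi> z) \<bullet> \<pi>' z w = G (\<pi> z) \<bullet> w" for w
      by (subst \<pi>'_eq[OF z], subst (2) Z_add[symmetric]) (simp add: inner_add_right inner_e G\<pi>[OF z])
    ultimately show ?thesis by simp
  qed

  \<comment> \<open>The signed root as new coordinate\<close>
  define \<sigma> where "\<sigma> = sgn d"
  have \<sigma>: "\<sigma> * \<sigma> = 1" "\<sigma> * d > 0" using d by (auto simp: \<sigma>_def sgn_if)
  have int1: "integral {0..1} (\<lambda>t::real. (1 - t) * b) = b / 2" for b :: real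
  proof -
    have "((\<lambda>t::real. (1 - t) * b) has_integral ((1 - 1\<^sup>2 / 2) * b - (0 - 0\<^sup>2 / 2) * b)) {0..1}"
      by (rule fundamental_theorem_of_calculus)
        (auto intro!: derivative_eq_intros simp flip: has_real_derivative_iff_has_vector_derivative)
    from integral_unique[OF this] show ?thesis by (simp only:) simp
  qed
  have aB0: "a z = (G' z e $ u) / 2" "B z = G' z e" "\<pi> z = z" if z: "z \<in> N0" "v z = 0" for z
  proof -
    show "\<pi> z = z" using z_eq[OF z(1)] z(2) by simp
    then have "c z t = z" for t using z(2) by (simp add: c_def)
    then show "a z = (G' z e $ u) / 2" "B z = G' z e"
      by (simp_all only: a_def int1) (simp add: B_def)
  qed
  \<comment> \<open>The sign \<open>\<sigma>\<close> makes the radicand positive at 0, where it is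
    \<open>\<sigma> * d / 2\<close>; continuity of \<open>a\<close> makes this persist
    nearby.\<close>
  define N where "N = {z \<in> N0. \<sigma> * a z > 0}"
  have "open N" unfolding N_def
    by (rule open_Collect_greater_on[OF N0(1)]) (intro continuous_intros cont_a)
  have v0: "v 0 = 0" by (simp add: v_def \<pi>0)
  have "\<sigma> * a 0 = \<sigma> * d / 2" using aB0(1)[OF N0(2) v0] d(1) by (simp add: H_eq e_def)
  then have "\<sigma> * a 0 > 0" using \<sigma>(2) by linarith
  then have "0 \<in> N" using N0(2) by (simp add: N_def)
  have NN0: "N \<subseteq> N0" by (auto simp: N_def)
  define y where "y z = v z * sqrt (\<sigma> * a z)" for z
  have v_der: "(v has_derivative (\<lambda>w. w $ u - \<pi>' z w $ u)) (at z)" if "z \<in> N0" for z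
    unfolding v_def
    by (intro has_derivative_diff bounded_linear_imp_has_derivative[OF blu]
        bounded_linear.has_derivative[OF blu] \<pi>'(1) that)
  have P_der: "((\<lambda>z. \<sigma> * (g z - g (\<pi> z))) has_derivative (\<lambda>w. v z * ((\<sigma> *\<^sub>R B z) \<bullet> w))) (at z)"
    if "z \<in> N" for z
  proof -
    have z: "z \<in> N0" "z \<in> W" using that NN0 N0(3) W'(3) by auto
    have "((\<lambda>z. \<sigma> * (g z - g (\<pi> z))) has_derivative (\<lambda>w. \<sigma> * (G z \<bullet> w - G (\<pi> z) \<bullet> w))) (at z)"
      by (intro has_derivative_mult_right has_derivative_diff grad g\<pi>_der z)
    moreover have "G z \<bullet> w - G (\<pi> z) \<bullet> w = v z * (B z \<bullet> w)" for w
      using G_diff[OF z(1)] by (metis inner_diff_left inner_scaleR_left)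
    ultimately show ?thesis by (simp add: mult_ac)
  qed
  have P_eq: "\<sigma> * (g z - g (\<pi> z)) = (v z)\<^sup>2 * (\<sigma> * a z)" if "z \<in> N" for z
    using g_diff[of z] that NN0 by auto
  have B_eq: "(\<sigma> *\<^sub>R B z) \<bullet> w = 2 * (\<sigma> * a z) * (w $ u - \<pi>' z w $ u)" if "z \<in> N" "v z = 0" for z w
  proof -
    have z: "z \<in> N0" "z \<in> W'" using that NN0 N0(3) by auto
    \<comment> \<open>Write \<open>w\<close> as \<open>\<pi>' z w + k *\<^sub>R e\<close>. Where
      \<open>v z = 0\<close> one has \<open>\<pi> z = z\<close>, so \<open>G\<pi>'\<close> kills the
      first part in the component \<open>u\<close> and only the multiple of \<open>e\<close>
      remains.\<close>
    define k where "k = w $ u - \<pi>' z w $ u"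
    have "\<pi>' z w + k *\<^sub>R e = (Z w + (\<pi>' z w $ u) *\<^sub>R e) + k *\<^sub>R e"
      using \<pi>'_eq[OF z(1), of w] by simp
    also have "\<dots> = Z w + (w $ u) *\<^sub>R e"
      by (simp add: k_def scaleR_left_diff_distrib)
    finally have "\<pi>' z w + k *\<^sub>R e = w" by (simp add: Z_add)
    then have "G' z w = G' z (\<pi>' z w) + k *\<^sub>R G' z e"
      by (metis blinfun.add_right blinfun.scaleR_right)
    then have "G' z w $ u = k * (G' z e $ u)"
      using G\<pi>'[OF z(1), of w] by (simp add: aB0(3)[OF z(1) that(2)])
    moreover have "B z \<bullet> w = G' z w $ u"
      using sym[OF z(2), of e w] by (simp add: aB0(2)[OF z(1) that(2)] inner_e)
    ultimately show ?thesis by (simp add: aB0(1)[OF z(1) that(2)] k_def)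
  qed
  have yC1: "C1_on N y" and
    y_der: "(y has_derivative (\<lambda>w. ((\<sigma> *\<^sub>R B 0) \<bullet> w) / (2 * sqrt (\<sigma> * a 0)))) (at 0)"
  proof -
    have pos: "\<sigma> * a z > 0" if "z \<in> N" for z using that by (simp add: N_def)
    have cont: "continuous_on N (\<lambda>z. \<sigma> * a z)" "continuous_on N (\<lambda>z. \<sigma> *\<^sub>R B z)"
      by (intro continuous_intros continuous_on_subset[OF _ NN0] cont_a cont_B)+
    note sq = signed_sqrt[where v = v and Dv = "\<lambda>z w. w $ u - \<pi>' z w $ u"
        and P = "\<lambda>z. \<sigma> * (g z - g (\<pi> z))" and a = "\<lambda>z. \<sigma> * a z" and B = "\<lambda>z. \<sigma> *\<^sub>R B z",
        OF \<open>open N\<close> v_der[OF subsetD[OF NN0]] P_der P_eq pos cont B_eq]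
    show "C1_on N y" unfolding y_def by (rule sq(2))
    show "(y has_derivative (\<lambda>w. ((\<sigma> *\<^sub>R B 0) \<bullet> w) / (2 * sqrt (\<sigma> * a 0)))) (at 0)"
      unfolding y_def by (rule sq(1)) (auto intro: \<open>0 \<in> N\<close>)
  qed
  define k where "k = sqrt (\<sigma> * a 0)"
  have k: "k > 0" using \<open>0 \<in> N\<close> by (simp add: k_def N_def)
  have "((\<sigma> *\<^sub>R B 0) \<bullet> w) / (2 * sqrt (\<sigma> * a 0)) = k * (w $ u - \<pi>' 0 w $ u)" for w
  proof -
    have "(\<sigma> *\<^sub>R B 0) \<bullet> w = 2 * (k * k) * (w $ u - \<pi>' 0 w $ u)"
      using B_eq[OF \<open>0 \<in> N\<close> v0] \<open>0 \<in> N\<close> by (simp add: k_def N_def)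
    then show ?thesis using k by (simp flip: k_def)
  qed
  then have y_der': "(y has_derivative (\<lambda>w. k * (w $ u - \<pi>' 0 w $ u))) (at 0)"
    using y_der by simp
  \<comment> \<open>The tangent vector \<open>\<pi>' 0 w\<close> satisfies one linear equation,
    \<open>H (\<pi>' 0 w) $ u = 0\<close>, which is solved for its
    \<open>u\<close>-component.\<close>
  have \<pi>'0: "\<pi>' 0 w = Z w - (H (Z w) $ u / d) *\<^sub>R e" for w
  proof -
    have "H (\<pi>' 0 w) $ u = 0" using G\<pi>'[OF N0(2)] by (simp add: H_eq \<pi>0)
    then have "H (Z w) $ u + \<pi>' 0 w $ u * d = 0"
      using linear_add[OF linH, of "Z w" "(\<pi>' 0 w $ u) *\<^sub>R e"] \<pi>'_eq[OF N0(2), of w]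
      by (simp only: linear_cmul[OF linH]) (simp add: d(1)[folded e_def])
    then have "\<pi>' 0 w $ u = - (H (Z w) $ u / d)" using d(2) by (simp add: field_simps)
    then show ?thesis by (subst \<pi>'_eq[OF N0(2)]) simp
  qed
  have NW: "N \<subseteq> W" using NN0 N0(3) W'(3) by auto
  have \<pi>NW: "\<pi> ` N \<subseteq> W" using \<pi>W NN0 W'(3) by auto
  have g_eq: "g z = g (\<pi> z) + sgn d * (y z)\<^sup>2" if "z \<in> N" for z
  proof -
    have "\<sigma> * (y z)\<^sup>2 = \<sigma> * (\<sigma> * (g z - g (\<pi> z)))"
      using P_eq[OF that] that by (auto simp: y_def power_mult_distrib N_def)
    also have "\<dots> = g z - g (\<pi> z)" using \<sigma>(1) by (simp flip: mult.assoc)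
    finally show ?thesis by (simp add: \<sigma>_def)
  qed
  have "\<pi> (zero_coord u z) = \<pi> z" for z by (simp add: \<pi>_def Z_def)
  moreover have "y 0 = 0" by (simp add: y_def v0)
  moreover have "k \<noteq> 0" using k by simp
  ultimately show ?thesis
    using \<open>open N\<close> \<open>0 \<in> N\<close> NW C1_on_subset[OF C1\<pi> NN0] \<pi>NW \<pi>0 \<pi>'(1)[OF N0(2)]
      g\<pi>_der[OF subsetD[OF NN0]] g_eq yC1 y_der' \<pi>'0[unfolded Z_def e_def]
    by (intro that[of N \<pi> "blinfun_apply (\<pi>' 0)" y k])
qed

subsection \<open>The Morse lemma with a diagonal Hessian\<close>

text \<open>Induction on \<open>J\<close>, splitting off one direction by
  \<open>split_variable\<close>. The reduced function has gradient \<open>G \<circ> \<pi>\<close>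
  and Hessian \<open>H \<circ> D\<pi>\<close>, which is diagonal on the remaining directions with
  the same entries \<open>d\<close>. The condition on \<open>D\<close> says that the
  \<open>y j\<close> have a diagonal invertible Jacobian on \<open>J\<close>, which later makes the
  full chart invertible.\<close>

lemma Morse_diagonal:
  fixes g :: "real^'n \<Rightarrow> real" and G :: "real^'n \<Rightarrow> real^'n"
  assumes "finite J" "open W" "0 \<in> W"
    and "\<And>x. x \<in> W \<Longrightarrow> (g has_derivative (\<lambda>v. G x \<bullet> v)) (at x)"
    and "C1_on W G" "(G has_derivative H) (at 0)"
    and "\<And>i. i \<in> J \<Longrightarrow> G 0 $ i = 0"
    and "\<And>i j. i \<in> J \<Longrightarrow> j \<in> J \<Longrightarrow> H (axis j 1) $ i = (if i = j then d i else 0)"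
    and "\<And>i. i \<in> J \<Longrightarrow> d i \<noteq> 0"
  shows "\<exists>N y. open N \<and> 0 \<in> N \<and>
    (\<forall>j\<in>J. C1_on N (y j) \<and> y j 0 = 0 \<and>
      (\<exists>D. (y j has_derivative D) (at 0) \<and> (\<forall>i\<in>J. D (axis i 1) = 0 \<longleftrightarrow> i \<noteq> j))) \<and>
    (\<forall>z\<in>N. (\<forall>i. i \<notin> J \<longrightarrow> z $ i = 0) \<longrightarrow> g z = g 0 + (\<Sum>j\<in>J. sgn (d j) * (y j z)\<^sup>2))"
  using assms
proof (induction J arbitrary: g G W H rule: finite_induct)
  case empty
  show ?case
  proof (intro exI[of _ UNIV] exI conjI ballI impI)
    fix z :: "real^'n" assume "\<forall>i. i \<notin> {} \<longrightarrow> z $ i = 0"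
    then have "z = 0" by (simp add: vec_eq_iff)
    then show "g z = g 0 + (\<Sum>j\<in>{}. sgn (d j) * (undefined j z)\<^sup>2)" by simp
  qed auto
next
  case (insert u J)
  let ?Z = "zero_coord u :: real^'n \<Rightarrow> real^'n"
  have blZ: "bounded_linear ?Z" by (rule bounded_linear_zero_coord)
  have Z0: "?Z 0 = 0" "?Z (axis u 1) = 0" by (simp_all add: vec_eq_iff zero_coord_nth axis_def)
  have Zj: "?Z (axis j 1) = axis j 1" if "j \<in> J" for j
    using that insert.hyps(2) by (auto simp: vec_eq_iff zero_coord_nth axis_def)
  have Hu: "H (axis u 1) $ u = d u" "d u \<noteq> 0" "G 0 $ u = 0"
    using insert.prems(6-8) by auto
  obtain N \<pi> D\<pi> y c where N: "open N" "0 \<in> N" "N \<subseteq> W"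
    and \<pi>: "C1_on N \<pi>" "\<pi> ` N \<subseteq> W" "\<pi> 0 = 0" "(\<pi> has_derivative D\<pi>) (at 0)"
    and \<pi>Z: "\<And>z. \<pi> (?Z z) = \<pi> z"
    and D\<pi>: "\<And>w. D\<pi> w = ?Z w - (H (?Z w) $ u / d u) *\<^sub>R axis u 1"
    and g\<pi>: "\<And>z. z \<in> N \<Longrightarrow> ((\<lambda>z. g (\<pi> z)) has_derivative (\<lambda>v. G (\<pi> z) \<bullet> v)) (at z)"
    and g: "\<And>z. z \<in> N \<Longrightarrow> g z = g (\<pi> z) + sgn (d u) * (y z)\<^sup>2"
    and y: "C1_on N y" "y 0 = 0" "(y has_derivative (\<lambda>w. c * (w $ u - D\<pi> w $ u))) (at 0)" "c \<noteq> 0"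
    by (rule split_variable[OF insert.prems(1-5) Hu(3,1,2)]) (assumption, rule that, assumption+)
  \<comment> \<open>The correction term of \<open>D\<pi>\<close> contains the mixed entry of the
    Hessian for \<open>u\<close> and \<open>j\<close>, which is zero; so the remaining diagonal is
    unchanged.\<close>
  have D\<pi>_axis: "D\<pi> (axis j 1) = axis j 1" if "j \<in> J" for j
    using that insert.hyps(2) insert.prems(7)[of u j] by (auto simp: D\<pi> Zj)
  have D\<pi>_u: "D\<pi> (axis u 1) = 0"
    using linear_0[OF has_derivative_linear[OF insert.prems(5)]] by (simp add: D\<pi> Z0)
  have C1: "C1_on N (\<lambda>z. G (\<pi> z))" by (rule C1_on_compose[OF insert.prems(4) \<pi>(1,2)])
  have der: "((\<lambda>z. G (\<pi> z)) has_derivative (\<lambda>w. H (D\<pi> w))) (at 0)"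
    by (rule has_derivative_compose[OF \<pi>(4)]) (simp add: \<pi>(3) insert.prems(5))
  have hess: "H (D\<pi> (axis j 1)) $ i = (if i = j then d i else 0)" if "i \<in> J" "j \<in> J" for i j
    using that insert.prems(7) by (simp add: D\<pi>_axis)
  have crit: "G (\<pi> 0) $ i = 0" if "i \<in> J" for i
    using that insert.prems(6) by (simp add: \<pi>(3))
  have "\<exists>N y. open N \<and> 0 \<in> N \<and>
    (\<forall>j\<in>J. C1_on N (y j) \<and> y j 0 = 0 \<and>
      (\<exists>D. (y j has_derivative D) (at 0) \<and> (\<forall>i\<in>J. D (axis i 1) = 0 \<longleftrightarrow> i \<noteq> j))) \<and>
    (\<forall>z\<in>N. (\<forall>i. i \<notin> J \<longrightarrow> z $ i = 0) \<longrightarrow> g (\<pi> z) = g (\<pi> 0) + (\<Sum>j\<in>J. sgn (d j) * (y j z)\<^sup>2))"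
    by (rule insert.IH[OF N(1,2) g\<pi> C1 der crit hess insert.prems(8)]) simp_all
  then obtain N' y' where N': "open N'" "0 \<in> N'"
    and y'_all: "\<forall>j\<in>J. C1_on N' (y' j) \<and> y' j 0 = 0 \<and>
      (\<exists>D. (y' j has_derivative D) (at 0) \<and> (\<forall>i\<in>J. D (axis i 1) = 0 \<longleftrightarrow> i \<noteq> j))"
    and g'_all: "\<forall>z\<in>N'. (\<forall>i. i \<notin> J \<longrightarrow> z $ i = 0) \<longrightarrow>
      g (\<pi> z) = g (\<pi> 0) + (\<Sum>j\<in>J. sgn (d j) * (y' j z)\<^sup>2)"
    by (elim exE conjE) (rule that)
  note y' = bspec[OF y'_all] and g' = mp[OF bspec[OF g'_all]]
  define M where "M = N \<inter> ?Z -` N'"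
  \<comment> \<open>The induction hypothesis speaks only of points vanishing outside
    \<open>J\<close>. Composing with \<open>zero_coord u\<close> reaches such points, and
    \<open>\<pi>\<close> does not notice the change.\<close>
  define Y where "Y j = (if j = u then y else (\<lambda>z. y' j (?Z z)))" for j
  have "open (?Z -` N')"
    using blZ N'(1) by (intro open_vimage) (simp_all add: linear_continuous_on)
  then have M: "open M" "0 \<in> M" using N N' Z0 by (auto simp: M_def)
  have Yu: "Y u = y" by (simp add: Y_def)
  have Yj: "Y j = (\<lambda>z. y' j (?Z z))" if "j \<in> J" for j
    using that insert.hyps(2) by (auto simp: Y_def)
  have "C1_on M (Y j) \<and> Y j 0 = 0 \<and>
      (\<exists>D. (Y j has_derivative D) (at 0) \<and> (\<forall>i\<in>insert u J. D (axis i 1) = 0 \<longleftrightarrow> i \<noteq> j))"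
    if "j \<in> insert u J" for j
  proof (cases "j = u")
    case True
    have "c * (axis i 1 $ u - D\<pi> (axis i 1) $ u) = 0 \<longleftrightarrow> i \<noteq> u" if "i \<in> insert u J" for i
      using that insert.hyps(2) y(4) D\<pi>_axis D\<pi>_u by (auto simp: axis_def)
    then have "\<exists>D. (y has_derivative D) (at 0) \<and> (\<forall>i\<in>insert u J. D (axis i 1) = 0 \<longleftrightarrow> i \<noteq> u)"
      using y(3) by (intro exI[of _ "\<lambda>w. c * (w $ u - D\<pi> w $ u)"]) simp
    moreover have "C1_on M y" by (rule C1_on_subset[OF y(1)]) (auto simp: M_def)
    ultimately show ?thesis unfolding True Yu using y(2) by simp
  next
    case False
    then have j: "j \<in> J" using that by simp
    obtain D where D: "(y' j has_derivative D) (at 0)" "\<forall>i\<in>J. D (axis i 1) = 0 \<longleftrightarrow> i \<noteq> j"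
      using y'[OF j] by auto
    have "C1_on M (Y j)"
      unfolding Yj[OF j] using y'[OF j]
      by (intro C1_on_compose[OF _ C1_on_bounded_linear[OF blZ], of N']) (auto simp: M_def)
    moreover have "Y j 0 = 0" using y'[OF j] by (simp add: Yj[OF j] Z0)
    moreover have "(Y j has_derivative (\<lambda>w. D (?Z w))) (at 0)"
      unfolding Yj[OF j]
      by (rule has_derivative_compose[OF bounded_linear_imp_has_derivative[OF blZ]]) (simp add: Z0 D(1))
    moreover have "D (?Z (axis i 1)) = 0 \<longleftrightarrow> i \<noteq> j" if "i \<in> insert u J" for i
    proof (cases "i = u")
      case True
      then show ?thesis
        using False linear_0[OF has_derivative_linear[OF D(1)]] by (auto simp: Z0)
    next
      case False
      then show ?thesis using D(2) that Zj by auto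
    qed
    ultimately show ?thesis by blast
  qed
  moreover have "g z = g 0 + (\<Sum>j\<in>insert u J. sgn (d j) * (Y j z)\<^sup>2)"
    if z: "z \<in> M" "\<forall>i. i \<notin> insert u J \<longrightarrow> z $ i = 0" for z
  proof -
    have "g (\<pi> (?Z z)) = g (\<pi> 0) + (\<Sum>j\<in>J. sgn (d j) * (y' j (?Z z))\<^sup>2)"
      using z by (intro g') (auto simp: M_def zero_coord_nth)
    moreover have "g z = g (\<pi> z) + sgn (d u) * (y z)\<^sup>2" using g z(1) by (auto simp: M_def)
    moreover have "(\<Sum>j\<in>J. sgn (d j) * (y' j (?Z z))\<^sup>2) = (\<Sum>j\<in>J. sgn (d j) * (Y j z)\<^sup>2)"
      by (intro sum.cong) (auto simp: Yj)
    ultimately show ?thesis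
      using insert.hyps by (simp add: \<pi>Z \<pi>(3) Yu)
  qed
  ultimately show ?case using M by blast
qed

subsection \<open>Diagonalization of symmetric matrices\<close>

text \<open>A maximizer of the Rayleigh quotient on the unit sphere of \<open>E\<close> is an
  eigenvector: \<open>Q\<close> is nonnegative on \<open>E\<close> and vanishes at \<open>v\<close>,
  while its first-order change in the direction of the residual \<open>r\<close> is
  \<open>2 * t * (r \<bullet> r)\<close>, so \<open>r\<close> must be 0.\<close>

lemma selfadjoint_has_eigenvector:
  fixes T :: "'a::euclidean_space \<Rightarrow> 'a"
  assumes T: "linear T" and E: "subspace E" "E \<noteq> {0}" and TE: "T ` E \<subseteq> E"
    and sym: "\<And>v w. v \<in> E \<Longrightarrow> w \<in> E \<Longrightarrow> T v \<bullet> w = v \<bullet> T w"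
  obtains v c where "v \<in> E" "norm v = 1" "T v = c *\<^sub>R v"
proof -
  define K where "K = E \<inter> sphere 0 1"
  obtain w where w: "w \<in> E" "w \<noteq> 0" using E subspace_0 by blast
  then have "(1 / norm w) *\<^sub>R w \<in> K" using E(1) by (simp add: K_def subspace_scale)
  then have "K \<noteq> {}" by auto
  moreover have "compact K"
    unfolding K_def by (simp add: E(1) closed_subspace closed_Int_compact)
  moreover have "continuous_on K (\<lambda>v. T v \<bullet> v)"
    using T by (intro continuous_intros linear_continuous_on) (simp add: linear_conv_bounded_linear)
  ultimately obtain v where v: "v \<in> K" and max: "\<And>w. w \<in> K \<Longrightarrow> T w \<bullet> w \<le> T v \<bullet> v"
    using continuous_attains_sup[of K "\<lambda>v. T v \<bullet> v"] by auto
  have vE: "v \<in> E" "norm v = 1" using v by (auto simp: K_def)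
  define c where "c = T v \<bullet> v"
  define Q where "Q w = c * (w \<bullet> w) - T w \<bullet> w" for w
  have Q_nonneg: "Q w \<ge> 0" if "w \<in> E" for w
  proof (cases "w = 0")
    case False
    then have "(1 / norm w) *\<^sub>R w \<in> K" using E(1) that by (simp add: K_def subspace_scale)
    from max[OF this] have "(T w \<bullet> w) / (norm w * norm w) \<le> c"
      using T by (simp add: linear_cmul c_def)
    then show ?thesis
      using False by (simp add: Q_def divide_le_eq dot_square_norm power2_eq_square)
  qed (simp add: Q_def)
  define r where "r = c *\<^sub>R v - T v"
  have r: "r \<in> E" using E(1) vE TE by (auto simp: r_def subspace_diff subspace_scale)
  have Qv: "Q v = 0" using vE by (simp add: Q_def c_def dot_square_norm)
  have Q_exp: "Q (v + t *\<^sub>R r) = 2 * t * (r \<bullet> r) + t\<^sup>2 * Q r" for t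
  proof -
    have "Q (v + t *\<^sub>R r) = Q v + 2 * t * (c * (v \<bullet> r) - T v \<bullet> r) + t\<^sup>2 * Q r"
      using T sym[OF r vE(1)]
      by (simp add: Q_def linear_add linear_cmul inner_add_left inner_add_right power2_eq_square
          inner_commute algebra_simps)
    also have "c * (v \<bullet> r) - T v \<bullet> r = r \<bullet> r" by (simp add: r_def inner_diff_left)
    finally show ?thesis by (simp add: Qv)
  qed
  have "r \<bullet> r = 0"
  proof (rule ccontr)
    assume "r \<bullet> r \<noteq> 0"
    then have rr: "r \<bullet> r > 0" by simp
    \<comment> \<open>A negative step so short that the quadratic term of \<open>Q_exp\<close>
      cannot outweigh the linear one: \<open>t * Q r \<ge> - (r \<bullet> r)\<close>. Adding 1
      avoids division by 0.\<close>
    define t where "t = - (r \<bullet> r) / (Q r + 1)"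
    have Qr: "Q r \<ge> 0" by (rule Q_nonneg[OF r])
    have t: "t < 0" using rr Qr by (simp add: t_def divide_neg_pos)
    have "0 \<le> t * (2 * (r \<bullet> r) + t * Q r)"
      using Q_nonneg[of "v + t *\<^sub>R r"] vE(1) r E(1)
      by (simp add: Q_exp subspace_add subspace_scale power2_eq_square algebra_simps)
    then have "2 * (r \<bullet> r) + t * Q r \<le> 0" using t by (simp add: zero_le_mult_iff)
    moreover have "t * Q r \<ge> - (r \<bullet> r)"
    proof -
      have "- (t * Q r) = (r \<bullet> r) * (Q r / (Q r + 1))" by (simp add: t_def)
      also have "\<dots> \<le> (r \<bullet> r) * 1" using rr Qr by (intro mult_left_mono) auto
      finally show ?thesis by simp
    qed
    ultimately show False using rr by simp
  qed
  then have "T v = c *\<^sub>R v" by (simp add: r_def)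
  then show ?thesis using that vE by blast
qed

text \<open>Induction on the dimension: by symmetry \<open>T\<close> maps the orthogonal complement
  in \<open>E\<close> of an eigenvector into itself.\<close>

lemma selfadjoint_orthonormal_eigenbasis:
  fixes T :: "'a::euclidean_space \<Rightarrow> 'a"
  assumes "linear T" "subspace E" "T ` E \<subseteq> E"
    and "\<And>v w. v \<in> E \<Longrightarrow> w \<in> E \<Longrightarrow> T v \<bullet> w = v \<bullet> T w"
  shows "\<exists>B. B \<subseteq> E \<and> span B = E \<and> pairwise orthogonal B \<and>
    (\<forall>b\<in>B. norm b = 1 \<and> (\<exists>c. T b = c *\<^sub>R b))"
  using assms
proof (induction "dim E" arbitrary: E rule: less_induct)
  case less
  show ?case
  proof (cases "E = {0}")
    case True
    then show ?thesis by (intro exI[of _ "{}"]) auto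
  next
    case False
    obtain v c where v: "v \<in> E" "norm v = 1" "T v = c *\<^sub>R v"
      using selfadjoint_has_eigenvector[OF less.prems(1,2) False less.prems(3,4)] by metis
    define E' where "E' = {w \<in> E. v \<bullet> w = 0}"
    have vv: "v \<bullet> v = 1" using v(2) by (simp add: dot_square_norm)
    have sub: "subspace E'"
      using less.prems(2) by (auto simp: E'_def subspace_def inner_add_right)
    have "v \<notin> E'" using vv by (simp add: E'_def)
    then have "E' \<subset> E" using v(1) unfolding E'_def by blast
    then have "dim E' < dim E"
      using dim_psubset[of E' E] sub less.prems(2) by (simp add: span_eq_iff[THEN iffD2])
    moreover have "T ` E' \<subseteq> E'"
    proof
      fix x assume "x \<in> T ` E'"
      then obtain w where w: "w \<in> E" "v \<bullet> w = 0" "x = T w" by (auto simp: E'_def)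
      then have "v \<bullet> x = T v \<bullet> w" using less.prems(4)[OF v(1) w(1)] by simp
      then show "x \<in> E'" using w v(3) less.prems(3) by (auto simp: E'_def)
    qed
    moreover have "T x \<bullet> w = x \<bullet> T w" if "x \<in> E'" "w \<in> E'" for x w
      using that less.prems(4) by (auto simp: E'_def)
    ultimately obtain B where B: "B \<subseteq> E'" "span B = E'" "pairwise orthogonal B"
      "\<forall>b\<in>B. norm b = 1 \<and> (\<exists>c. T b = c *\<^sub>R b)"
      using less.hyps[OF _ less.prems(1) sub] by metis
    have "insert v B \<subseteq> E" using v(1) B(1) by (auto simp: E'_def)
    moreover have "E \<subseteq> span (insert v B)"
    proof
      fix x assume x: "x \<in> E"
      have "x - (v \<bullet> x) *\<^sub>R v \<in> E'"
        using x v(1) less.prems(2) vv by (auto simp: E'_def inner_diff_right subspace_diff subspace_scale)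
      then show "x \<in> span (insert v B)" using B(2) by (auto simp: span_insert)
    qed
    ultimately have "span (insert v B) = E"
      using less.prems(2) span_minimal by blast
    moreover have "pairwise orthogonal (insert v B)"
      using B(1,3) by (auto simp: pairwise_insert orthogonal_def E'_def inner_commute)
    ultimately show ?thesis
      using \<open>insert v B \<subseteq> E\<close> B(4) v(2,3) by (intro exI[of _ "insert v B"]) blast
  qed
qed

section \<open>Eigenbasis and index of a symmetric block\<close>

lemma dim_supported: "dim {v :: real^'n. \<forall>i. i \<notin> J \<longrightarrow> v $ i = 0} = card J"
proof -
  define d :: "(real^'n) set" where "d = (\<lambda>i. axis i 1) ` J"
  have "axis i (1::real) \<in> d \<longleftrightarrow> i \<in> J" for i by (auto simp: d_def axis_eq_axis)
  then have "{v :: real^'n. \<forall>i. i \<notin> J \<longrightarrow> v $ i = 0} = {x. \<forall>i\<in>Basis. i \<notin> d \<longrightarrow> x \<bullet> i = 0}"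
    by (auto simp: Basis_vec_def inner_axis)
  moreover have "d \<subseteq> Basis" by (auto simp: d_def Basis_vec_def)
  moreover have "card d = card J"
    unfolding d_def by (rule card_image) (auto simp: inj_on_def axis_eq_axis)
  ultimately show ?thesis using dim_substandard[of d] by simp
qed

text \<open>The block of \<open>A\<close> acts as a selfadjoint operator on the vectors supported in
  \<open>J\<close>. That space has dimension \<open>card J\<close>, so the eigenbasis can be indexed
  by \<open>J\<close> itself; each basis vector later carries the coordinate of its index.\<close>

lemma symmetric_diagonalization_on:
  fixes A :: "'n::finite \<Rightarrow> 'n \<Rightarrow> real"
  assumes sym: "\<And>i j. i \<in> J \<Longrightarrow> j \<in> J \<Longrightarrow> A i j = A j i"
  obtains b :: "'n \<Rightarrow> real^'n" and d where
    "\<And>i j. j \<in> J \<Longrightarrow> i \<notin> J \<Longrightarrow> b j $ i = 0"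
    "\<And>i j. i \<in> J \<Longrightarrow> j \<in> J \<Longrightarrow> b i \<bullet> b j = (if i = j then 1 else 0)"
    "\<And>v. \<forall>i. i \<notin> J \<longrightarrow> v $ i = 0 \<Longrightarrow> (\<Sum>j\<in>J. (b j \<bullet> v) *\<^sub>R b j) = v"
    "\<And>i j. i \<in> J \<Longrightarrow> j \<in> J \<Longrightarrow> (\<Sum>l\<in>J. A i l * b j $ l) = d j * b j $ i"
    "card {j \<in> J. d j < 0} = num_neg_eigenvalues_on J A"
proof -
  define E :: "(real^'n) set" where "E = {v. \<forall>i. i \<notin> J \<longrightarrow> v $ i = 0}"
  define T :: "real^'n \<Rightarrow> real^'n" where "T v = (\<chi> i. if i \<in> J then \<Sum>l\<in>J. A i l * v $ l else 0)" for v
  have E: "subspace E" by (auto simp: E_def subspace_def)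
  have T: "linear T"
    by (rule linearI) (auto simp: T_def vec_eq_iff distrib_left sum.distrib sum_distrib_left mult_ac)
  have TE: "T ` E \<subseteq> E" by (auto simp: T_def E_def)
  have inner_E: "v \<bullet> w = (\<Sum>i\<in>J. v $ i * w $ i)" if "v \<in> E" for v w :: "real^'n"
    unfolding inner_vec_def inner_real_def
    using that by (intro sum.mono_neutral_right) (auto simp: E_def)
  have "T v \<bullet> w = v \<bullet> T w" if "v \<in> E" "w \<in> E" for v w
  proof -
    have "T v \<bullet> w = (\<Sum>i\<in>J. \<Sum>l\<in>J. A i l * v $ l * w $ i)"
      using TE that by (subst inner_E) (auto simp: T_def sum_distrib_right)
    also have "\<dots> = (\<Sum>l\<in>J. \<Sum>i\<in>J. A i l * v $ l * w $ i)" by (rule sum.swap)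
    also have "\<dots> = v \<bullet> T w"
      using that sym by (subst inner_E) (auto simp: T_def sum_distrib_left mult_ac intro!: sum.cong)
    finally show ?thesis .
  qed
  then obtain B where B: "B \<subseteq> E" "span B = E" "pairwise orthogonal B"
    and B1: "\<And>b. b \<in> B \<Longrightarrow> norm b = 1" "\<And>b. b \<in> B \<Longrightarrow> \<exists>c. T b = c *\<^sub>R b"
    using selfadjoint_orthonormal_eigenbasis[OF T E TE] by metis
  have indep: "independent B"
    using B(3) B1(1) by (intro pairwise_orthogonal_independent) force+
  have "card B = card J"
    using basis_card_eq_dim[of B E] B indep dim_supported[of J] by (simp add: E_def)
  then obtain b where b: "bij_betw b J B"
    using finite_same_card_bij[of J B] independent_imp_finite[OF indep] by auto
  have bB: "b j \<in> B" if "j \<in> J" for j using b that bij_betwE by blast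
  have bE: "b j \<in> E" if "j \<in> J" for j using bB[OF that] B(1) by auto
  have inj: "inj_on b J" using b bij_betw_def by blast
  have orth: "b i \<bullet> b j = (if i = j then 1 else 0)" if "i \<in> J" "j \<in> J" for i j
  proof (cases "i = j")
    case True
    then show ?thesis using B1(1)[OF bB[OF that(1)]] by (simp add: dot_square_norm)
  next
    case False
    then have "b i \<noteq> b j" using inj that by (auto dest: inj_onD)
    then show ?thesis using B(3) bB that False by (auto simp: pairwise_def orthogonal_def)
  qed
  have "\<forall>j\<in>J. \<exists>c. T (b j) = c *\<^sub>R b j" using B1(2)[OF bB] by blast
  from bchoice[OF this] obtain d where d_all: "\<forall>j\<in>J. T (b j) = d j *\<^sub>R b j" by (elim exE) (rule that)
  note d = bspec[OF d_all]
  have expand: "(\<Sum>j\<in>J. (b j \<bullet> v) *\<^sub>R b j) = v" if v: "v \<in> E" for v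
  proof -
    define w where "w = v - (\<Sum>j\<in>J. (b j \<bullet> v) *\<^sub>R b j)"
    have "w \<in> span B"
      unfolding B(2) w_def 
      using v bE by (auto intro!: subspace_diff[OF E] subspace_sum[OF E] subspace_scale[OF E])
    moreover have "orthogonal w x" if x: "x \<in> B" for x
    proof -
      obtain i where i: "i \<in> J" "x = b i"
        using x bij_betw_imp_surj_on[OF b] by blast
      have "(\<Sum>j\<in>J. (b j \<bullet> v) *\<^sub>R b j) \<bullet> b i = (\<Sum>j\<in>J. (b j \<bullet> v) * (b j \<bullet> b i))"
        by (simp add: inner_sum_left)
      also have "\<dots> = (\<Sum>j\<in>J. if j = i then b j \<bullet> v else 0)"
        by (intro sum.cong) (auto simp: orth i)
      finally show ?thesis
        using i by (simp add: w_def orthogonal_def inner_diff_left inner_diff_right inner_commute)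
    qed
    ultimately have "orthogonal w w" by (rule orthogonal_to_span)
    then show ?thesis by (simp add: w_def orthogonal_self)
  qed
  have eigen: "eigenspace_on J A c = {v \<in> E. T v = c *\<^sub>R v}" for c
    by (auto simp: eigenspace_on_def E_def T_def vec_eq_iff)
  \<comment> \<open>By symmetry an eigenvector for \<open>c\<close> is orthogonal to every
    \<open>b j\<close> with another eigenvalue, so its expansion involves only indices with
    \<open>d j = c\<close>.\<close>
  have eigen_span: "eigenspace_on J A c = span (b ` {j \<in> J. d j = c})" for c
  proof
    show "span (b ` {j \<in> J. d j = c}) \<subseteq> eigenspace_on J A c"
    proof (rule span_minimal)
      show "b ` {j \<in> J. d j = c} \<subseteq> eigenspace_on J A c" using bE d by (auto simp: eigen)
      show "subspace (eigenspace_on J A c)"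
        unfolding eigen using E T by (auto simp: subspace_def linear_0 linear_add linear_cmul algebra_simps)
    qed
    show "eigenspace_on J A c \<subseteq> span (b ` {j \<in> J. d j = c})"
    proof
      fix v assume "v \<in> eigenspace_on J A c"
      then have v: "v \<in> E" "T v = c *\<^sub>R v" by (auto simp: eigen)
      have "b j \<bullet> v = 0" if "j \<in> J" "d j \<noteq> c" for j
      proof -
        have "d j * (b j \<bullet> v) = T (b j) \<bullet> v" using d that by simp
        also have "\<dots> = b j \<bullet> T v"
          using \<open>\<And>w v. v \<in> E \<Longrightarrow> w \<in> E \<Longrightarrow> T v \<bullet> w = v \<bullet> T w\<close> bE that v by blast
        also have "\<dots> = c * (b j \<bullet> v)" using v by simp
        finally show ?thesis using that by simp
      qed
      then have "(b j \<bullet> v) *\<^sub>R b j \<in> span (b ` {j \<in> J. d j = c})" if "j \<in> J" for j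
        using that by (cases "d j = c") (auto intro: span_scale span_base simp: span_0)
      then have "(\<Sum>j\<in>J. (b j \<bullet> v) *\<^sub>R b j) \<in> span (b ` {j \<in> J. d j = c})"
        by (rule span_sum)
      then show "v \<in> span (b ` {j \<in> J. d j = c})" by (simp add: expand v(1))
    qed
  qed
  have dim_eigen: "dim (eigenspace_on J A c) = card {j \<in> J. d j = c}" for c
  proof -
    have "independent (b ` {j \<in> J. d j = c})"
      by (rule independent_mono[OF indep]) (use bB in auto)
    moreover have "card (b ` {j \<in> J. d j = c}) = card {j \<in> J. d j = c}"
      using inj by (intro card_image) (auto simp: inj_on_def)
    ultimately show ?thesis unfolding eigen_span by (simp add: dim_eq_card_independent)
  qed
  have eigenvalue: "eigenvalue_on J A c \<longleftrightarrow> c \<in> d ` J" for c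
  proof
    assume "eigenvalue_on J A c"
    then obtain v where "v \<in> span (b ` {j \<in> J. d j = c})" "v \<noteq> 0"
      unfolding eigenvalue_on_def eigen_span by blast
    then have "{j \<in> J. d j = c} \<noteq> {}" by (metis image_empty span_empty singletonD)
    then show "c \<in> d ` J" by auto
  next
    assume "c \<in> d ` J"
    then obtain j where j: "j \<in> J" "d j = c" by auto
    then have "b j \<in> eigenspace_on J A c" unfolding eigen_span by (auto intro: span_base)
    moreover have "b j \<noteq> 0" using B1(1)[OF bB[OF j(1)]] by auto
    ultimately show "eigenvalue_on J A c" unfolding eigenvalue_on_def by blast
  qed
  \<comment> \<open>Grouping the indices by the value of \<open>d\<close> turns the sum of
    eigenspace dimensions into a count of negative entries with multiplicity.\<close>
  have "num_neg_eigenvalues_on J A = (\<Sum>c\<in>d ` {j \<in> J. d j < 0}. card {j \<in> J. d j = c})"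
    unfolding num_neg_eigenvalues_on_def dim_eigen eigenvalue by (intro sum.cong) auto
  also have "\<dots> = (\<Sum>c\<in>d ` {j \<in> J. d j < 0}. \<Sum>j\<in>{j \<in> {j \<in> J. d j < 0}. d j = c}. 1)"
    by (intro sum.cong) (auto intro!: arg_cong[where f = card])
  also have "\<dots> = card {j \<in> J. d j < 0}"
    by (subst sum.image_gen[symmetric]) simp_all
  finally have count: "card {j \<in> J. d j < 0} = num_neg_eigenvalues_on J A" by simp
  have "(\<Sum>l\<in>J. A i l * b j $ l) = d j * b j $ i" if "i \<in> J" "j \<in> J" for i j
    using arg_cong[OF d[OF that(2)], of "\<lambda>x. x $ i"] that by (simp add: T_def)
  moreover have "b j $ i = 0" if "j \<in> J" "i \<notin> J" for i j using bE that by (auto simp: E_def)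
  moreover have "(\<Sum>j\<in>J. (b j \<bullet> v) *\<^sub>R b j) = v" if "\<forall>i. i \<notin> J \<longrightarrow> v $ i = 0" for v
    using expand that by (simp add: E_def)
  ultimately show ?thesis using orth count by (intro that[of b d])
qed

lemma nonsingular_on_trivial_kernel:
  assumes "nonsingular_on J A" "\<And>i. i \<in> J \<Longrightarrow> (\<Sum>l\<in>J. A i l * v l) = 0" "m \<in> J"
  shows "v m = 0"
proof -
  obtain B where B: "\<And>i j. i \<in> J \<Longrightarrow> j \<in> J \<Longrightarrow> (\<Sum>l\<in>J. B i l * A l j) = (if i = j then 1 else 0)"
    using assms(1) unfolding nonsingular_on_def by blast
  have "v m = (\<Sum>j\<in>J. if m = j then v j else 0)" using assms(3) by simp
  also have "\<dots> = (\<Sum>j\<in>J. (\<Sum>l\<in>J. B m l * A l j) * v j)"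
    by (intro sum.cong) (auto simp: B assms(3))
  also have "\<dots> = (\<Sum>j\<in>J. \<Sum>l\<in>J. B m l * (A l j * v j))"
    by (simp add: sum_distrib_right mult.assoc)
  also have "\<dots> = (\<Sum>l\<in>J. \<Sum>j\<in>J. B m l * (A l j * v j))" by (rule sum.swap)
  also have "\<dots> = 0" by (simp add: assms(2) flip: sum_distrib_left)
  finally show ?thesis .
qed

subsection \<open>Normal form at a nondegenerate M-stationary point\<close>

lemma gradient_expand:
  fixes D :: "real^'n \<Rightarrow> real"
  assumes "linear D"
  shows "D v = (\<chi> i. D (axis i 1)) \<bullet> v"
proof -
  have "D v = D (\<Sum>i\<in>UNIV. v $ i *\<^sub>R axis i 1)"
    by (simp add: basis_expansion scalar_mult_eq_scaleR[symmetric])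
  also have "\<dots> = (\<Sum>i\<in>UNIV. v $ i * D (axis i 1))"
    using assms by (simp add: linear_sum linear_cmul)
  finally show ?thesis by (simp add: inner_vec_def mult.commute)
qed

text \<open>Trades the operator-valued derivative for a C^1 vector field, the form in which the
  reduction \<open>G \<circ> \<pi>\<close> of \<open>split_variable\<close> is expressed.\<close>

lemma C2_on_gradient:
  fixes f :: "real^'n \<Rightarrow> real"
  assumes "C2_on S f"
  obtains G where "\<And>x. x \<in> S \<Longrightarrow> (f has_derivative (\<lambda>v. G x \<bullet> v)) (at x)" "C1_on S G"
proof -
  obtain f' where f': "\<forall>x\<in>S. (f has_derivative blinfun_apply (f' x)) (at x)" "C1_on S f'"
    using assms unfolding C2_on_def by blast
  define G where "G x = (\<chi> i. blinfun_apply (f' x) (axis i 1))" for x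
  have "blinfun_apply (f' x) v = G x \<bullet> v" for x v
    unfolding G_def by (rule gradient_expand) (simp add: blinfun.bounded_linear_right bounded_linear.linear)
  then have "blinfun_apply (f' x) = (\<lambda>v. G x \<bullet> v)" for x by auto
  then have "(f has_derivative (\<lambda>v. G x \<bullet> v)) (at x)" if "x \<in> S" for x
    using f'(1) that by metis
  moreover have "C1_on S G"
    by (rule C1_on_vec) (simp add: G_def C1_on_linear_compose[OF blinfun.bounded_linear_left f'(2)])
  ultimately show ?thesis by (rule that)
qed

lemma partial_eq:
  assumes "(f has_derivative D) (at x)"
  shows "partial i f x = D (axis i 1)"
proof -
  have "((\<lambda>t. f (x + t *\<^sub>R axis i 1)) has_derivative (\<lambda>t. D (t *\<^sub>R axis i 1))) (at 0)"
    by (rule has_derivative_compose[of "\<lambda>t. x + t *\<^sub>R axis i 1"]) (auto intro!: derivative_eq_intros assms)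
  moreover have "(\<lambda>t. D (t *\<^sub>R axis i 1)) = (\<lambda>t. D (axis i 1) * t)"
    using linear_cmul[OF has_derivative_linear[OF assms]] by auto
  ultimately have "((\<lambda>t. f (x + t *\<^sub>R axis i 1)) has_real_derivative D (axis i 1)) (at 0)"
    by (simp add: has_field_derivative_def)
  then show ?thesis unfolding partial_def by (rule DERIV_imp_deriv)
qed

text \<open>By the mean value theorem the increment \<open>p i\<close> is \<open>x $ i\<close> times
  a value of the partial derivative in direction \<open>i\<close> near \<open>x0\<close>. That value
  is nonzero, so \<open>p i\<close> and \<open>x $ i\<close> vanish together.\<close>

lemma telescoping_coordinates:
  fixes f :: "real^'n \<Rightarrow> real"
  assumes grad: "\<And>x. (f has_derivative (\<lambda>v. G x \<bullet> v)) (at x)" and cont: "continuous_on UNIV G"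
    and x0: "\<And>i. i \<in> I \<Longrightarrow> x0 $ i = 0" "\<And>i. i \<in> I \<Longrightarrow> G x0 $ i \<noteq> 0"
  obtains S p where "open S" "x0 \<in> S"
    "\<And>i. i \<in> I \<Longrightarrow> C1_on S (p i)"
    "\<And>i x. i \<in> I \<Longrightarrow> x \<in> S \<Longrightarrow> p i x = 0 \<longleftrightarrow> x $ i = 0"
    "\<And>i. i \<in> I \<Longrightarrow> (p i has_derivative (\<lambda>v. G x0 $ i * v $ i)) (at x0)"
    "\<And>x. (\<Sum>i\<in>I. p i x) = f x - f (\<chi> i. if i \<in> I then 0 else x $ i)"
proof -
  obtain e where e: "bij_betw e I {0..<card I}" using ex_bij_betw_finite_nat[of I] by auto
  have e_inj: "e i = e j \<longleftrightarrow> i = j" if "i \<in> I" "j \<in> I" for i j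
    using e that by (auto simp: bij_betw_def inj_on_def)
  have e_less: "e i < card I" if "i \<in> I" for i using e that bij_betwE by fastforce
  \<comment> \<open>Truncations leading from the deletion of all of \<open>I\<close> at
    \<open>t = 0\<close> to the identity at \<open>t = card I\<close>. As \<open>e\<close> counts
    from 0, passing from \<open>e i\<close> to \<open>Suc (e i)\<close> restores exactly the
    coordinate \<open>i\<close>.\<close>
  define Q where "Q t x = (\<chi> i. if i \<in> I \<and> t \<le> e i then 0 else x $ i)" for t and x :: "real^'n"
  have "linear (Q t)" for t by (rule linearI) (auto simp: Q_def vec_eq_iff)
  then have blQ: "bounded_linear (Q t)" for t by (simp add: linear_conv_bounded_linear)
  have Qx0: "Q t x0 = x0" for t using x0(1) by (auto simp: Q_def vec_eq_iff)
  have Q_Suc: "Q (Suc (e i)) x = Q (e i) x + (x $ i) *\<^sub>R axis i 1" if "i \<in> I" for i x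
    using that e_inj by (auto simp: Q_def vec_eq_iff axis_def not_less_eq_eq intro: le_antisym)
  define p where "p i x = f (Q (Suc (e i)) x) - f (Q (e i) x)" for i x
  have C1f: "C1_on UNIV f"
    by (rule C1_onI[OF grad]) (intro continuous_intros cont)
  have "continuous_on UNIV (\<lambda>x. G x $ i)" for i using cont by (intro continuous_intros)
  then have "open {x. G x $ i \<noteq> 0}" for i
    using open_Collect_neq[of "\<lambda>x. G x $ i" "\<lambda>_. 0"] by simp
  then have "open (\<Inter>i\<in>I. {x. G x $ i \<noteq> 0})" by (intro open_INT) auto
  moreover have "x0 \<in> (\<Inter>i\<in>I. {x. G x $ i \<noteq> 0})" using x0(2) by auto
  ultimately obtain r where r: "r > 0" "ball x0 r \<subseteq> (\<Inter>i\<in>I. {x. G x $ i \<noteq> 0})"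
    using open_contains_ball by metis
  define S where "S = ball x0 r"
  have C1p: "C1_on S (p i)" for i
    unfolding p_def
    by (intro C1_on_diff C1_on_compose[OF C1f C1_on_bounded_linear[OF blQ]] subset_UNIV)
  have zero: "p i x = 0 \<longleftrightarrow> x $ i = 0" if i: "i \<in> I" and x: "x \<in> S" for i x
  proof
    assume "x $ i = 0"
    then show "p i x = 0" by (simp add: p_def Q_Suc[OF i])
  next
    assume p0: "p i x = 0"
    define w where "w t = Q (e i) x + t *\<^sub>R ((x $ i) *\<^sub>R axis i 1)" for t
    have "((\<lambda>t. f (w t)) has_derivative (\<lambda>h. G (w t) \<bullet> (h *\<^sub>R ((x $ i) *\<^sub>R axis i 1)))) (at t within {0..1})" for t
      unfolding w_def by (rule has_derivative_compose[OF _ grad]) (auto intro!: derivative_eq_intros)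
    then obtain t where t: "0 < t" "t < 1" "f (w 1) - f (w 0) = G (w t) \<bullet> (x $ i *\<^sub>R axis i 1)"
      using mvt_simple[of 0 1 "\<lambda>t. f (w t)" "\<lambda>t h. G (w t) \<bullet> (h *\<^sub>R ((x $ i) *\<^sub>R axis i 1))"] by auto
    \<comment> \<open>Each coordinate in \<open>I\<close> of the intermediate point is that of
      \<open>x\<close>, kept, scaled by \<open>t\<close> or deleted, and \<open>x0\<close> vanishes
      there; outside \<open>I\<close> it agrees with \<open>x\<close>. Hence it stays in the
      ball.\<close>
    have "norm (w t - x0) \<le> norm (x - x0)"
    proof (rule norm_le_componentwise_cart)
      fix m
      show "norm ((w t - x0) $ m) \<le> norm ((x - x0) $ m)"
        using t x0(1)[of m] i x0(1)[OF i]
        by (auto simp: w_def Q_def axis_def abs_mult mult_left_le_one_le)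
    qed
    then have "w t \<in> ball x0 r" using x by (simp add: S_def dist_norm norm_minus_commute)
    then have "G (w t) $ i \<noteq> 0" using r i by blast
    moreover have "f (w 1) - f (w 0) = 0" using p0 by (simp add: p_def w_def Q_Suc[OF i])
    ultimately show "x $ i = 0" using t(3) by (simp add: inner_axis)
  qed
  have der: "(p i has_derivative (\<lambda>v. G x0 $ i * v $ i)) (at x0)" if i: "i \<in> I" for i
  proof -
    have "((\<lambda>x. f (Q t x)) has_derivative (\<lambda>v. G x0 \<bullet> Q t v)) (at x0)" for t
      using has_derivative_compose[OF bounded_linear_imp_has_derivative[OF blQ] grad, of t x0] by (simp add: Qx0)
    from has_derivative_diff[OF this[of "Suc (e i)"] this[of "e i"]]
    show ?thesis
      by (simp add: p_def[abs_def] Q_Suc[OF i] inner_add_right inner_axis mult.commute)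
  qed
  have sum: "(\<Sum>i\<in>I. p i x) = f x - f (\<chi> i. if i \<in> I then 0 else x $ i)" for x
  proof -
    have "(\<Sum>i\<in>I. p i x) = (\<Sum>t\<in>{0..<card I}. f (Q (Suc t) x) - f (Q t x))"
      unfolding p_def by (rule sum.reindex_bij_betw[OF e])
    also have "\<dots> = f (Q (card I) x) - f (Q 0 x)"
      using sum_lessThan_telescope[of "\<lambda>t. f (Q t x)" "card I"] by (simp add: atLeast0LessThan)
    also have "Q (card I) x = x" using e_less by (fastforce simp: Q_def vec_eq_iff)
    also have "Q 0 x = (\<chi> i. if i \<in> I then 0 else x $ i)" by (simp add: Q_def)
    finally show ?thesis .
  qed
  show ?thesis
    by (rule that[of S p]) (use r(1) C1p zero der sum in \<open>auto simp: S_def\<close>)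
qed

text \<open>Pulls \<open>f\<close> back along \<open>x0 + L z\<close>, where \<open>L\<close> sends
  the axes in \<open>J\<close> to the eigenvectors of the Hessian block, so that
  \<open>Morse_diagonal\<close> applies. \<open>R\<close> returns the eigenbasis coordinates, and
  the signs are those of the eigenvalues.\<close>

lemma Morse_on_support:
  fixes f :: "real^'n \<Rightarrow> real" and x0 :: "real^'n"
  assumes grad: "\<And>x. (f has_derivative (\<lambda>v. G x \<bullet> v)) (at x)" and C1: "C1_on UNIV G"
    and crit: "\<And>i. i \<in> J \<Longrightarrow> G x0 $ i = 0"
    and ns: "nonsingular_on J (hessian f x0)"
  obtains N and R :: "real^'n \<Rightarrow> real^'n" and y \<sigma> where "open N" "0 \<in> N" "bounded_linear R"
    "\<And>v. R v = 0 \<Longrightarrow> \<forall>i. i \<notin> J \<longrightarrow> v $ i = 0 \<Longrightarrow> v = 0"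
    "\<And>v i. i \<notin> J \<Longrightarrow> R v $ i = 0"
    "\<And>j. j \<in> J \<Longrightarrow> C1_on N (y j)" "\<And>j. j \<in> J \<Longrightarrow> y j 0 = 0"
    "\<And>j. j \<in> J \<Longrightarrow> \<exists>D. (y j has_derivative D) (at 0) \<and> (\<forall>i\<in>J. D (axis i 1) = 0 \<longleftrightarrow> i \<noteq> j)"
    "\<And>v. R v \<in> N \<Longrightarrow>
      f (x0 + (\<chi> i. if i \<in> J then v $ i else 0)) = f x0 + (\<Sum>j\<in>J. \<sigma> j * (y j (R v))\<^sup>2)"
    "\<And>j. j \<in> J \<Longrightarrow> \<sigma> j = 1 \<or> \<sigma> j = -1"
    "card {j \<in> J. \<sigma> j = -1} = num_neg_eigenvalues_on J (hessian f x0)"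
proof -
  obtain H where H: "(G has_derivative H) (at x0)"
    using C1 unfolding C1_on_def by blast
  have linH: "linear H" using H has_derivative_linear by blast
  have "partial j f = (\<lambda>x. G x $ j)" for j
    using partial_eq[OF grad, of j] by (auto simp: inner_axis)
  then have hess: "hessian f x0 i j = H (axis i 1) $ j" for i j
    unfolding hessian_def
    using partial_eq[OF bounded_linear.has_derivative[OF bounded_linear_vec_nth H]] by simp
  have sym: "hessian f x0 i j = hessian f x0 j i" for i j
    using gradient_derivative_symmetric[OF open_UNIV UNIV_I grad H, of "axis i 1" "axis j 1"]
    by (simp add: hess inner_axis)
  obtain b :: "'n \<Rightarrow> real^'n" and d where
    b0: "\<And>i j. j \<in> J \<Longrightarrow> i \<notin> J \<Longrightarrow> b j $ i = 0" and
    bb: "\<And>i j. i \<in> J \<Longrightarrow> j \<in> J \<Longrightarrow> b i \<bullet> b j = (if i = j then 1 else 0)" and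
    expand: "\<And>v. \<forall>i. i \<notin> J \<longrightarrow> v $ i = 0 \<Longrightarrow> (\<Sum>j\<in>J. (b j \<bullet> v) *\<^sub>R b j) = v" and
    eig: "\<And>i j. i \<in> J \<Longrightarrow> j \<in> J \<Longrightarrow> (\<Sum>l\<in>J. hessian f x0 i l * b j $ l) = d j * b j $ i" and
    count: "card {j \<in> J. d j < 0} = num_neg_eigenvalues_on J (hessian f x0)"
    by (rule symmetric_diagonalization_on[of J "hessian f x0"]) (rule sym, rule that, assumption+)
  have inner_b: "b j \<bullet> v = (\<Sum>i\<in>J. b j $ i * v $ i)" if "j \<in> J" for j v
    unfolding inner_vec_def inner_real_def
    using b0 that by (intro sum.mono_neutral_right) auto
  \<comment> \<open>This is where ND2 enters: an eigenvector for the eigenvalue 0 would lie in the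
    kernel of a nonsingular block.\<close>
  have d0: "d j \<noteq> 0" if j: "j \<in> J" for j
  proof
    assume "d j = 0"
    then have "b j $ m = 0" if "m \<in> J" for m
      using nonsingular_on_trivial_kernel[OF ns, of "\<lambda>l. b j $ l"] eig j that by simp
    then show False using bb[OF j j] inner_b[OF j] by simp
  qed
  define L where "L z = (\<Sum>j\<in>J. z $ j *\<^sub>R b j)" for z :: "real^'n"
  have "linear L" by (rule linearI) (auto simp: L_def algebra_simps sum.distrib scaleR_sum_right)
  then have blL: "bounded_linear L" by (simp add: linear_conv_bounded_linear)
  \<comment> \<open>\<open>R\<close> plays two roles: it inverts \<open>L\<close> on vectors
    supported in \<open>J\<close> (see \<open>LR\<close>), and as the adjoint of \<open>L\<close>
    (see \<open>R_inner\<close>) it turns the gradient of \<open>f\<close> into that of the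
    pullback.\<close>
  define R :: "real^'n \<Rightarrow> real^'n" where "R v = (\<chi> j. if j \<in> J then b j \<bullet> v else 0)" for v
  have "linear R" by (rule linearI) (auto simp: R_def vec_eq_iff inner_add_right)
  then have blR: "bounded_linear R" by (simp add: linear_conv_bounded_linear)
  have LR: "L (R v) = (\<chi> i. if i \<in> J then v $ i else 0)" for v
  proof -
    let ?v = "\<chi> i. if i \<in> J then v $ i else 0"
    have "L (R v) = (\<Sum>j\<in>J. (b j \<bullet> ?v) *\<^sub>R b j)"
      unfolding L_def by (intro sum.cong) (auto simp: R_def inner_b)
    also have "\<dots> = ?v" by (rule expand) simp
    finally show ?thesis .
  qed
  have L_axis: "L (axis j 1) = b j" if "j \<in> J" for j
  proof -
    have "L (axis j 1) = (\<Sum>i\<in>J. if i = j then b i else 0)"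
      unfolding L_def by (intro sum.cong) (auto simp: axis_def)
    then show ?thesis using that by simp
  qed
  have R_inner: "R u \<bullet> v = u \<bullet> L v" for u v
  proof -
    have "R u \<bullet> v = (\<Sum>j\<in>J. (b j \<bullet> u) * v $ j)"
      unfolding inner_vec_def[of "R u" v] inner_real_def
      by (subst sum.mono_neutral_right[of UNIV J]) (auto simp: R_def)
    then show ?thesis by (simp add: L_def inner_sum_right inner_commute mult.commute)
  qed
  have L0: "L 0 = 0" by (simp add: L_def)
  have aff: "((\<lambda>z. x0 + L z) has_derivative L) (at z)" for z
    using has_derivative_add[OF has_derivative_const bounded_linear_imp_has_derivative[OF blL]] by simp
  have g: "((\<lambda>z. f (x0 + L z)) has_derivative (\<lambda>v. R (G (x0 + L z)) \<bullet> v)) (at z)" for z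
    unfolding R_inner by (rule has_derivative_compose[OF aff grad])
  have C1g: "C1_on UNIV (\<lambda>z. R (G (x0 + L z)))"
    by (intro C1_on_linear_compose[OF blR] C1_on_compose[OF C1] C1_on_add C1_on_const
        C1_on_bounded_linear blL subset_UNIV)
  have Hg: "((\<lambda>z. R (G (x0 + L z))) has_derivative (\<lambda>v. R (H (L v)))) (at 0)"
    by (intro bounded_linear.has_derivative[OF blR] has_derivative_compose[OF aff]) (simp add: L0 H)
  have Hb: "H (b j) $ m = d j * b j $ m" if j: "j \<in> J" and m: "m \<in> J" for j m
  proof -
    have "H (b j) $ m = (\<chi> i. H (axis i 1) $ m) \<bullet> b j"
      by (rule gradient_expand)
        (simp add: bounded_linear.linear has_derivative_bounded_linear[OF bounded_linear.has_derivative[OF bounded_linear_vec_nth H]])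
    also have "\<dots> = (\<Sum>l\<in>J. hessian f x0 m l * b j $ l)"
      by (subst inner_commute, subst inner_b[OF j]) (simp add: hess[symmetric] sym[of _ m] mult.commute)
    finally show ?thesis using eig[OF m j] by simp
  qed
  have hess': "R (H (L (axis j 1))) $ i = (if i = j then d i else 0)" if "i \<in> J" "j \<in> J" for i j
  proof -
    have "R (H (L (axis j 1))) $ i = (\<Sum>m\<in>J. b i $ m * (d j * b j $ m))"
      using that by (simp add: R_def L_axis inner_b Hb)
    also have "\<dots> = d j * (b i \<bullet> b j)"
      using that by (simp add: inner_b sum_distrib_left mult_ac)
    finally show ?thesis using that by (simp add: bb)
  qed
  have crit': "R (G (x0 + L 0)) $ i = 0" if "i \<in> J" for i
    using that crit by (simp add: R_def inner_b L0)
  have "\<exists>N y. open N \<and> 0 \<in> N \<and>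
    (\<forall>j\<in>J. C1_on N (y j) \<and> y j 0 = 0 \<and>
      (\<exists>D. (y j has_derivative D) (at 0) \<and> (\<forall>i\<in>J. D (axis i 1) = 0 \<longleftrightarrow> i \<noteq> j))) \<and>
    (\<forall>z\<in>N. (\<forall>i. i \<notin> J \<longrightarrow> z $ i = 0) \<longrightarrow>
      f (x0 + L z) = f (x0 + L 0) + (\<Sum>j\<in>J. sgn (d j) * (y j z)\<^sup>2))"
    by (rule Morse_diagonal[OF finite[of J] open_UNIV UNIV_I g C1g Hg])
      (assumption | rule crit' hess' d0)+
  then obtain N y where N: "open N" "0 \<in> N"
    and y: "\<forall>j\<in>J. C1_on N (y j) \<and> y j 0 = 0 \<and>
      (\<exists>D. (y j has_derivative D) (at 0) \<and> (\<forall>i\<in>J. D (axis i 1) = 0 \<longleftrightarrow> i \<noteq> j))"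
    and f_eq: "\<forall>z\<in>N. (\<forall>i. i \<notin> J \<longrightarrow> z $ i = 0) \<longrightarrow>
      f (x0 + L z) = f (x0 + L 0) + (\<Sum>j\<in>J. sgn (d j) * (y j z)\<^sup>2)"
    by (elim exE conjE) (rule that)
  show ?thesis
  proof (rule that[of N R y "\<lambda>j. sgn (d j)"])
    show "v = 0" if "R v = 0" "\<forall>i. i \<notin> J \<longrightarrow> v $ i = 0" for v
      using LR[of v] that by (simp add: L0 vec_eq_iff) metis
    show "f (x0 + (\<chi> i. if i \<in> J then v $ i else 0)) = f x0 + (\<Sum>j\<in>J. sgn (d j) * (y j (R v))\<^sup>2)"
      if "R v \<in> N" for v
      using mp[OF bspec[OF f_eq that]] by (simp add: LR L0) (simp add: R_def)
    have "{j \<in> J. sgn (d j) = -1} = {j \<in> J. d j < 0}" by (auto simp: sgn_if)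
    then show "card {j \<in> J. sgn (d j) = -1} = num_neg_eigenvalues_on J (hessian f x0)"
      using count by simp
  qed (use N y blR d0 in \<open>auto simp: R_def sgn_if\<close>)
qed

theorem theorem1:
  fixes f :: "real^'n \<Rightarrow> real" and xbar :: "real^'n" and s k QI :: nat
  assumes "s < CARD('n)"
    and "C2_on UNIV f"
    and "nondegenerate_M_stationary s f xbar"
    and "l0_norm xbar = k"
    and "quadratic_index f xbar = QI"
  shows "\<exists>U V \<Psi> (\<sigma> :: 'n \<Rightarrow> real).
    local_C1_coordinates xbar U V \<Psi> \<and>
    \<Psi> ` (U \<inter> sparse_set s) = V \<inter> sparse_block (I0 xbar) (s - k) \<and>
    (\<forall>j\<in>I1 xbar. \<sigma> j = 1 \<or> \<sigma> j = -1) \<and>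
    (\<forall>y \<in> V \<inter> sparse_block (I0 xbar) (s - k).
       f (inv_into U \<Psi> y) =
         f xbar + (\<Sum>i\<in>I0 xbar. y $ i) + (\<Sum>j\<in>I1 xbar. \<sigma> j * (y $ j)\<^sup>2)) \<and>
    card {j \<in> I1 xbar. \<sigma> j = -1} = QI"
proof -
  define I where "I = I0 xbar"
  define J where "J = I1 xbar"
  have IJ: "i \<in> I \<longleftrightarrow> i \<notin> J" for i by (auto simp: I_def J_def I0_def I1_def)
  have xI: "xbar $ i = 0" if "i \<in> I" for i using that by (simp add: I_def I0_def)
  have xJ: "xbar $ j \<noteq> 0" if "j \<in> J" for j using that by (simp add: J_def I1_def)
  obtain G where grad: "\<And>x. (f has_derivative (\<lambda>v. G x \<bullet> v)) (at x)" and C1: "C1_on UNIV G"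
    using C2_on_gradient[OF assms(2)] by auto
  have partial: "partial i f x = G x $ i" for i x
    using partial_eq[OF grad] by (simp add: inner_axis)
  have sparse: "k \<le> s" and crit: "\<And>i. i \<in> J \<Longrightarrow> G xbar $ i = 0"
    and nd1: "\<And>i. k < s \<Longrightarrow> i \<in> I \<Longrightarrow> G xbar $ i \<noteq> 0"
    and nd2: "nonsingular_on J (hessian f xbar)"
    using assms(3,4) partial
    by (auto simp: nondegenerate_M_stationary_def M_stationary_def sparse_set_def I_def J_def)
  define Q where "Q x = (\<chi> i. if i \<in> I then 0 else x $ i)" for x :: "real^'n"

  \<comment> \<open>Coordinates on and off the support\<close>
  obtain N and R :: "real^'n \<Rightarrow> real^'n" and y \<sigma>
    where N: "open N" "0 \<in> N" and R: "bounded_linear R"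
    and R_inj: "\<And>v. R v = 0 \<Longrightarrow> \<forall>i. i \<notin> J \<longrightarrow> v $ i = 0 \<Longrightarrow> v = 0"
    and R_supp: "\<And>v i. i \<notin> J \<Longrightarrow> R v $ i = 0"
    and y: "\<And>j. j \<in> J \<Longrightarrow> C1_on N (y j)" "\<And>j. j \<in> J \<Longrightarrow> y j 0 = 0"
      "\<And>j. j \<in> J \<Longrightarrow> \<exists>D. (y j has_derivative D) (at 0) \<and> (\<forall>i\<in>J. D (axis i 1) = 0 \<longleftrightarrow> i \<noteq> j)"
    and f_J: "\<And>v. R v \<in> N \<Longrightarrow>
      f (xbar + (\<chi> i. if i \<in> J then v $ i else 0)) = f xbar + (\<Sum>j\<in>J. \<sigma> j * (y j (R v))\<^sup>2)"
    and \<sigma>: "\<And>j. j \<in> J \<Longrightarrow> \<sigma> j = 1 \<or> \<sigma> j = -1"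
      "card {j \<in> J. \<sigma> j = -1} = num_neg_eigenvalues_on J (hessian f xbar)"
    by (rule Morse_on_support[OF grad C1 crit nd2]) (assumption, rule that, assumption+)
  have linR: "linear R" using R by (simp add: linear_conv_bounded_linear)

  \<comment> \<open>One interface for both cases: increments of \<open>f\<close> with
    \<open>c i\<close> the partial derivative if \<open>k < s\<close>, plain coordinates with
    \<open>c i = 1\<close> if \<open>k = s\<close>. The sum formula is demanded only for
    \<open>k < s\<close>.\<close>
  have "\<exists>S p c. open S \<and> xbar \<in> S \<and> (\<forall>i\<in>I. C1_on S (p i)) \<and>
      (\<forall>i\<in>I. \<forall>x\<in>S. p i x = 0 \<longleftrightarrow> x $ i = 0) \<and>
      (\<forall>i\<in>I. c i \<noteq> 0 \<and> (p i has_derivative (\<lambda>v. c i * v $ i)) (at xbar)) \<and>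
      (k < s \<longrightarrow> (\<forall>x. (\<Sum>i\<in>I. p i x) = f x - f (Q x)))"
  proof (cases "k < s")
    case True
    obtain S p where "open S" "xbar \<in> S" "\<And>i. i \<in> I \<Longrightarrow> C1_on S (p i)"
      "\<And>i x. i \<in> I \<Longrightarrow> x \<in> S \<Longrightarrow> p i x = 0 \<longleftrightarrow> x $ i = 0"
      "\<And>i. i \<in> I \<Longrightarrow> (p i has_derivative (\<lambda>v. G xbar $ i * v $ i)) (at xbar)"
      "\<And>x. (\<Sum>i\<in>I. p i x) = f x - f (\<chi> i. if i \<in> I then 0 else x $ i)"
      by (rule telescoping_coordinates[OF grad C1_on_imp_continuous_on[OF C1] xI nd1[OF True]])
        (assumption, assumption, rule that, assumption+)
    then show ?thesis
      using nd1[OF True] by (intro exI[of _ S] exI[of _ p] exI[of _ "\<lambda>i. G xbar $ i"]) (simp add: Q_def)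
  next
    case False
    then show ?thesis
      by (intro exI[of _ UNIV] exI[of _ "\<lambda>i x. x $ i"] exI[of _ "\<lambda>_. 1"])
        (auto intro: C1_on_bounded_linear bounded_linear_vec_nth bounded_linear_imp_has_derivative)
  qed
  then obtain S p c where S: "open S" "xbar \<in> S" and p_C1: "\<forall>i\<in>I. C1_on S (p i)"
    and p_zero: "\<forall>i\<in>I. \<forall>x\<in>S. p i x = 0 \<longleftrightarrow> x $ i = 0"
    and p_der: "\<forall>i\<in>I. c i \<noteq> 0 \<and> (p i has_derivative (\<lambda>v. c i * v $ i)) (at xbar)"
    and p_sum: "k < s \<longrightarrow> (\<forall>x. (\<Sum>i\<in>I. p i x) = f x - f (Q x))"
    by (elim exE conjE) (rule that)

  \<comment> \<open>The chart and the invertibility of its derivative\<close>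
  define F where "F x = (\<chi> i. if i \<in> J then y i (R (x - xbar)) else p i x)" for x
  \<comment> \<open>The last intersection keeps the coordinates in \<open>J\<close> nonzero, so
    every point of \<open>W\<close> has at least the support of \<open>xbar\<close>.\<close>
  define W where "W = S \<inter> (\<lambda>x. R (x - xbar)) -` N \<inter> (\<Inter>j\<in>J. {x. x $ j \<noteq> 0})"
  have Raff: "C1_on T (\<lambda>x. R (x - xbar))" for T
    by (intro C1_on_linear_compose[OF R] C1_on_diff C1_on_const C1_on_bounded_linear bounded_linear_ident)
  have "open W"
    unfolding W_def
    using S N C1_on_imp_continuous_on[OF Raff]
    by (intro open_Int open_vimage open_INT ballI open_Collect_neq continuous_intros) auto
  have "xbar \<in> W" using S N xJ linear_0[OF linR] by (simp add: W_def)
  have "C1_on W F"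
  proof (rule C1_on_vec)
    fix i
    show "C1_on W (\<lambda>x. F x $ i)"
    proof (cases "i \<in> J")
      case True
      have "C1_on W (\<lambda>x. y i (R (x - xbar)))"
        by (rule C1_on_compose[OF y(1)[OF True] Raff]) (auto simp: W_def)
      then show ?thesis using True by (simp add: F_def)
    next
      case False
      then have "C1_on S (p i)" using p_C1 IJ by blast
      then have "C1_on W (p i)" by (rule C1_on_subset) (auto simp: W_def)
      then show ?thesis using False by (simp add: F_def)
    qed
  qed
  then obtain D where D: "(F has_derivative D) (at xbar)"
    using \<open>xbar \<in> W\<close> unfolding C1_on_def by blast
  have D_nth: "((\<lambda>x. F x $ i) has_derivative (\<lambda>v. D v $ i)) (at xbar)" for i
    by (rule bounded_linear.has_derivative[OF bounded_linear_vec_nth D])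
  \<comment> \<open>The derivative is block triangular. The components outside \<open>J\<close> are
    \<open>c i * v $ i\<close> and force \<open>v\<close> to be supported in \<open>J\<close>; a
    component \<open>j\<close> in \<open>J\<close> then reduces to a nonzero multiple of
    \<open>R v $ j\<close>, since \<open>E\<close> kills the other axes of \<open>J\<close> and
    \<open>R v\<close> vanishes outside \<open>J\<close>.\<close>
  have D_inj: "v = 0" if Dv: "D v = 0" for v
  proof -
    have v_supp: "v $ i = 0" if "i \<notin> J" for i
    proof -
      have pi: "c i \<noteq> 0" "(p i has_derivative (\<lambda>v. c i * v $ i)) (at xbar)" using p_der IJ that by auto
      moreover have "(p i has_derivative (\<lambda>v. D v $ i)) (at xbar)"
        using D_nth[of i] that by (simp add: F_def)
      ultimately have "D v $ i = c i * v $ i" using has_derivative_unique by metis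
      then show ?thesis using Dv pi(1) by simp
    qed
    have "R v $ j = 0" if j: "j \<in> J" for j
    proof -
      obtain E where E: "(y j has_derivative E) (at 0)" "\<forall>i\<in>J. E (axis i 1) = 0 \<longleftrightarrow> i \<noteq> j"
        using y(3)[OF j] by blast
      have linE: "linear E" using E(1) has_derivative_linear by blast
      have "((\<lambda>x. R (x - xbar)) has_derivative R) (at xbar)"
        using bounded_linear.has_derivative[OF R has_derivative_diff[OF has_derivative_ident has_derivative_const]]
        by simp
      then have "((\<lambda>x. y j (R (x - xbar))) has_derivative (\<lambda>v. E (R v))) (at xbar)"
        by (rule has_derivative_compose) (simp add: linear_0[OF linR] E(1))
      moreover have "((\<lambda>x. y j (R (x - xbar))) has_derivative (\<lambda>v. D v $ j)) (at xbar)"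
        using D_nth[of j] j by (simp add: F_def)
      ultimately have "E (R v) = D v $ j" using has_derivative_unique by metis
      also have "E (R v) = (\<Sum>i\<in>UNIV. E (axis i 1) * R v $ i)"
        by (subst gradient_expand[OF linE]) (simp add: inner_vec_def)
      also have "\<dots> = (\<Sum>i\<in>UNIV. if i = j then E (axis j 1) * R v $ j else 0)"
        using E(2) R_supp by (intro sum.cong) auto
      finally have "E (axis j 1) * R v $ j = 0" using Dv by simp
      then show ?thesis using E(2) j by auto
    qed
    then have "R v = 0" using R_supp by (auto simp: vec_eq_iff)
    then show "v = 0" using R_inj v_supp by blast
  qed
  obtain U V where U: "open U" "xbar \<in> U" "U \<subseteq> W" and V: "open V"
    and bij: "bij_betw F U V" and inv: "C1_on V (inv_into U F)"
    by (rule C1_inverse_function[OF \<open>open W\<close> \<open>xbar \<in> W\<close> \<open>C1_on W F\<close> D D_inj]) (assumption, rule that)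
  have F_zero: "F x $ i = 0 \<longleftrightarrow> x $ i = 0" if "x \<in> U" "i \<in> I" for x i
    using that U(3) p_zero IJ by (auto simp: F_def W_def)
  have F_xbar: "F xbar = 0"
  proof -
    have "F xbar $ i = 0" for i
      using y(2)[of i] F_zero[OF U(2), of i] xI[of i] IJ[of i]
      by (cases "i \<in> J") (simp_all add: F_def linear_0[OF linR])
    then show ?thesis by (simp add: vec_eq_iff)
  qed

  \<comment> \<open>Sparsity and the normal form in the chart\<close>
  have "local_C1_coordinates xbar U V F"
    unfolding local_C1_coordinates_def
    using U V bij inv F_xbar C1_on_subset[OF \<open>C1_on W F\<close> U(3)] bij_betwE[OF bij] by force
  \<comment> \<open>The support of \<open>x\<close> is the disjoint union of \<open>J\<close>, of
    size \<open>k\<close>, and the indices in \<open>I\<close> where \<open>F x\<close> is nonzero;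
    since \<open>k \<le> s\<close>, the bound \<open>s\<close> leaves exactly \<open>s - k\<close>
    for the latter.\<close>
  moreover have sparse_iff: "x \<in> sparse_set s \<longleftrightarrow> F x \<in> sparse_block I (s - k)" if x: "x \<in> U" for x
  proof -
    have "x $ j \<noteq> 0" if "j \<in> J" for j using x that U(3) by (auto simp: W_def)
    then have "I1 x = J \<union> {i \<in> I. F x $ i \<noteq> 0}"
      using F_zero[OF x] IJ by (auto simp: I1_def)
    moreover have "J \<inter> {i \<in> I. F x $ i \<noteq> 0} = {}" using IJ by auto
    ultimately have "card (I1 x) = card J + card {i \<in> I. F x $ i \<noteq> 0}"
      by (simp add: card_Un_disjoint)
    then show ?thesis
      using assms(4) sparse by (auto simp: sparse_set_def sparse_block_def l0_norm_def J_def)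
  qed
  then have "F ` (U \<inter> sparse_set s) = V \<inter> sparse_block I (s - k)"
    using bij by (auto simp: bij_betw_def)
  moreover have "f (inv_into U F z) = f xbar + (\<Sum>i\<in>I. z $ i) + (\<Sum>j\<in>J. \<sigma> j * (z $ j)\<^sup>2)"
    if z: "z \<in> V \<inter> sparse_block I (s - k)" for z
  proof -
    define x where "x = inv_into U F z"
    have x: "x \<in> U" "F x = z"
      using z bij by (auto simp: x_def bij_betw_def inv_into_into f_inv_into_f)
    \<comment> \<open>Since \<open>xbar\<close> vanishes on \<open>I\<close>, deleting the
      coordinates in \<open>I\<close> from \<open>x\<close> gives a point to which the formula
      \<open>f_J\<close> on the support applies.\<close>
    have "xbar + (\<chi> i. if i \<in> J then (x - xbar) $ i else 0) = Q x"
      using IJ xI by (auto simp: vec_eq_iff Q_def)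
    then have "f (Q x) = f xbar + (\<Sum>j\<in>J. \<sigma> j * (y j (R (x - xbar)))\<^sup>2)"
      using f_J[of "x - xbar"] x(1) U(3) by (auto simp: W_def)
    also have "(\<Sum>j\<in>J. \<sigma> j * (y j (R (x - xbar)))\<^sup>2) = (\<Sum>j\<in>J. \<sigma> j * (z $ j)\<^sup>2)"
      by (intro sum.cong) (auto simp: F_def simp flip: x(2))
    finally have fQ: "f (Q x) = f xbar + (\<Sum>j\<in>J. \<sigma> j * (z $ j)\<^sup>2)" .
    have "f x = f (Q x) + (\<Sum>i\<in>I. z $ i)"
    proof (cases "k < s")
      case True
      have "(\<Sum>i\<in>I. z $ i) = (\<Sum>i\<in>I. p i x)"
        using IJ by (intro sum.cong) (auto simp: F_def simp flip: x(2))
      then show ?thesis using p_sum True by simp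
    next
      case False
      \<comment> \<open>Here \<open>s - k = 0\<close>, so the sparse block leaves no nonzero
        coordinate in \<open>I\<close>. By \<open>F_zero\<close> the same holds for
        \<open>x\<close>, and both \<open>Q x = x\<close> and the vanishing of the linear sum
        follow.\<close>
      then have z0: "z $ i = 0" if "i \<in> I" for i
        using z that by (auto simp: sparse_block_def)
      then have "Q x = x" using F_zero[OF x(1)] x(2) by (auto simp: Q_def vec_eq_iff)
      then show ?thesis using z0 by simp
    qed
    then show ?thesis using fQ by (simp flip: x_def)
  qed
  moreover have "card {j \<in> J. \<sigma> j = -1} = QI"
    using \<sigma>(2) assms(5) by (simp add: quadratic_index_def J_def)
  ultimately show ?thesis
    using \<sigma>(1) unfolding I_def J_def by (intro exI[of _ U] exI[of _ V] exI[of _ F] exI[of _ \<sigma>] conjI ballI)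
qed

end
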